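(* Fix $t\in\mathbb{N}$ and a compact set $\mathcal{K}_{[0:t]}\subseteq\mathbb{R}^{(1+t)d}$. In the Volterra setting of the context, assume that there are $R,M>0$ with $\sup_{s\in\mathbb{N}}\|\mathbf S_s\|_F\le R$ $\mathbb{P}$-a.s. and $\sup_{s\in\mathbb{N},x\in\mathbb{R}^d}\|\sigma(s,x)\|_F\le M$. Then the map $\Pi:x_{[0:t]}\mapsto\Pi_{x_{[0:t]}}=\beta(\mathbb{Q}_{x_{[0:t]}})$, from $\mathcal{K}_{[0:t]}$ (with the Euclidean norm) to $(\mathcal{N}_d,d_{\mathfrak J})$, is well-defined and Lipschitz, and $$\Pi_{x_{[0:t]}}=\operatorname*{argmin}_{u\in\mathcal{N}_d}\int_{v\in\mathcal{N}_d}d_{\mathfrak J}^2(u,v)\,\mathbb{Q}_{x_{[0:t]}}(dv).$$ Furthermore, the Lipschitz constant of $\Pi$ depends only on $t$ and $R$.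
   Context: $\operatorname{Sym}(d)$ (resp. $\operatorname{Sym}_+(d)$): real symmetric (resp. symmetric positive definite) $d\times d$ matrices; $\|\cdot\|_F$ the Frobenius norm; $\exp$ the matrix exponential. For a sequence $x$, $x_{[0:t]}=(x_0,\dots,x_t)$. Gaussian manifold: $\mathcal{N}_d=\{\mathcal{N}_d(\mathfrak m,\Sigma):\mathfrak m\in\mathbb{R}^d,\Sigma\in\operatorname{Sym}_+(d)\}$ is the manifold of non-degenerate Gaussian measures on $\mathbb{R}^d$ (coordinates $(\mathfrak m,\Sigma)$, tangent spaces $\mathbb{R}^d\times\operatorname{Sym}(d)$) with the Riemannian metric $\mathfrak J_{(\mathfrak m,\Sigma)}((u,X),(v,Y))=u^\top v+\frac12\operatorname{tr}(\Sigma^{-1}X\Sigma^{-1}Y)$ and induced distance $d_{\mathfrak J}$. It is a complete, non-positively curved (global NPC) space. For a Borel probability measure $q$ on $\mathcal{N}_d$ with finite first moment $\int d_{\mathfrak J}(y,x)q(dx)<\infty$, its barycenter $\beta(q)$ is the unique minimizer of $z\mapsto\int[d_{\mathfrak J}^2(z,x)-d_{\mathfrak J}^2(y,x)]\,q(dx)$ (independent of $y\in\mathcal{N}_d$). Volterra setting: $\mu:\mathbb{R}^{1+d}\to\mathbb{R}^d$ is $L_\mu$-Lipschitz and $\sigma:\mathbb{R}^{1+d}\to\operatorname{Sym}(d)$ is $L_\sigma$-Lipschitz. $\kappa:\{(t,r)\in\mathbb{N}^2:r\le t\}\to[0,1]$ is a Volterra kernel, i.e. $0<\sum_{r=0}^t\kappa(t,r)\le1$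 and $\kappa(t,0)=0$ whenever $t>0$. $\mathbf S=(\mathbf S_t)_{t\in\mathbb{N}}$ is a $\operatorname{Sym}(d)$-valued process on a probability space $(\Omega,\mathcal F,\mathbb P)$, independent of the i.i.d. standard Gaussian noise $(W_t)_t$ in $\mathbb{R}^d$. The Volterra process is $X_0=x_0$, $X_{t+1}=X_t+\operatorname{Drift}(t,X_{[0:t]})+\operatorname{Diffusion}(t,X_{[0:t]},\mathbf S_{[0:t]})W_t$ with $\operatorname{Drift}(t,x_{[0:t]})=\sum_{r=0}^t\kappa(t,r)\mu(t,x_r)$ and $\operatorname{Diffusion}(t,x_{[0:t]},s_{[0:t]})=\exp\big(\frac12\sum_{r=0}^t\kappa(t,r)[\sigma(t,x_r)+s_r]\big)$. For $x_{[0:t]}\in\mathbb{R}^{(1+t)d}$ and $s_{[0:t]}\in\operatorname{Sym}(d)^{1+t}$ put $$\Psi_t(x_{[0:t]},s_{[0:t]})=\mathcal{N}_d\Big(x_t+\operatorname{Drift}(t,x_{[0:t]}),\ \exp\Big(\sum_{r=0}^t\kappa(t,r)[\sigma(t,x_r)+s_r]\Big)\Big)\in\mathcal{N}_d,$$ let $\mathbb{Q}_{x_{[0:t]}}$ be the law of $\Psi_t(x_{[0:t]},\mathbf S_{[0:t]})$, and let $\Pi_{x_{[0:t]}}=\beta(\mathbb{Q}_{x_{[0:t]}})$ (the Gaussian random projection).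
   Formalization: The Lipschitz constant may also depend on d, L_μ, L_σ, M (formally also on the set Ω, harmless: only the law of S enters), not on t, R alone; that is false: t=0, κ(0,0)=1, S=0, σ=0, μ(s,x)=cx gives constant 1+c. *)

theory Defs
  imports "HOL-Probability.Probability"
begin

section \<open>Symmetric matrices and the matrix exponential\<close>

text \<open>
  Throughout, the norm of \<^typ>\<open>real^'d^'d\<close> is the Frobenius norm: the norm of
  \<^typ>\<open>'a^'d\<close> is the \<open>\<ell>\<^sup>2\<close>-norm of the norms of the components. Multiplication
  \<open>A * B\<close> of the type class, on the other hand, is componentwise, so the library's
  \<^const>\<open>exp\<close> and \<open>A ^ n\<close> are of no use for matrices.
\<close>

definition Sym :: "(real^'d^'d) set" where
  "Sym = {A. transpose A = A}"

definition SPD :: "(real^'d^'d) set" where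
  "SPD = {A \<in> Sym. \<forall>v. v \<noteq> 0 \<longrightarrow> 0 < v \<bullet> (A *v v)}"

primrec matpow :: "real^'d^'d \<Rightarrow> nat \<Rightarrow> real^'d^'d" where
  "matpow A 0 = mat 1"
| "matpow A (Suc n) = A ** matpow A n"

definition matexp :: "real^'d^'d \<Rightarrow> real^'d^'d" where
  "matexp A = (\<Sum>n. (1 / fact n) *\<^sub>R matpow A n)"


section \<open>The Gaussian manifold\<close>

text \<open>
  A point of the manifold is given by its global coordinates \<open>(m, \<Sigma>)\<close>; it stands for the
  measure \<open>gaussian (m, \<Sigma>)\<close>. Lemma \<open>inj_on_gaussian\<close> below shows that
  distinct points stand for distinct measures.
\<close>

type_synonym 'd gpoint = "(real^'d) \<times> (real^'d^'d)"

definition gauss_manifold :: "'d::finite gpoint set" where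
  "gauss_manifold = UNIV \<times> SPD"

definition gauss_density :: "'d::finite gpoint \<Rightarrow> real^'d \<Rightarrow> real" where
  "gauss_density p x =
     exp (- ((x - fst p) \<bullet> (matrix_inv (snd p) *v (x - fst p))) / 2)
       / sqrt ((2 * pi) ^ CARD('d) * det (snd p))"

definition gaussian :: "'d::finite gpoint \<Rightarrow> (real^'d) measure" where
  "gaussian p = density lborel (\<lambda>x. ennreal (gauss_density p x))"

lemma SPD_matrix_inv:
  fixes A :: "real^'d^'d"
  assumes "A \<in> SPD"
  shows SPD_inv_left: "matrix_inv A ** A = mat 1"
    and SPD_inv_right: "A ** matrix_inv A = mat 1"
    and SPD_matrix_inv_in: "matrix_inv A \<in> SPD"
proof -
  have sym: "transpose A = A" and pos: "\<And>v. v \<noteq> 0 \<Longrightarrow> 0 < v \<bullet> (A *v v)"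
    using assms by (auto simp: SPD_def Sym_def)
  have "\<And>v. A *v v = 0 \<Longrightarrow> v = 0"
    using pos by force
  then have "invertible A"
    using invertible_left_inverse matrix_left_invertible_ker by blast
  then have "\<exists>B. A ** B = mat 1 \<and> B ** A = mat 1"
    by (simp add: invertible_def)
  from someI_ex[OF this] show l: "matrix_inv A ** A = mat 1" and r: "A ** matrix_inv A = mat 1"
    by (simp_all add: matrix_inv_def)
  have "transpose (matrix_inv A) ** A = mat 1"
    using arg_cong[OF r, of transpose] by (simp add: matrix_transpose_mul sym)
  then have "transpose (matrix_inv A) = matrix_inv A"
    by (metis r matrix_mul_assoc matrix_mul_lid matrix_mul_rid)
  moreover have "0 < v \<bullet> (matrix_inv A *v v)" if "v \<noteq> 0" for v
  proof -
    have v: "A *v (matrix_inv A *v v) = v"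
      by (simp add: matrix_vector_mul_assoc r)
    then have "matrix_inv A *v v \<noteq> 0"
      using that by auto
    from pos[OF this] show ?thesis
      by (simp add: v inner_commute)
  qed
  ultimately show "matrix_inv A \<in> SPD"
    by (auto simp: SPD_def Sym_def)
qed

lemma SPD_det_pos:
  fixes A :: "real^'d^'d"
  assumes "A \<in> SPD"
  shows "0 < det A"
proof (rule ccontr)
  define B where "B s = (1 - s) *\<^sub>R mat 1 + s *\<^sub>R A" for s :: real
  have B: "B s \<in> SPD" if "0 \<le> s" "s \<le> 1" for s
  proof -
    have "0 < v \<bullet> (B s *v v)" if "v \<noteq> 0" for v
    proof -
      have *: "v \<bullet> (B s *v v) = (1 - s) * (v \<bullet> v) + s * (v \<bullet> (A *v v))"
        by (simp add: B_def matrix_vector_mult_add_rdistrib scaleR_matrix_vector_assoc[symmetric] inner_add_right)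
      have "0 < v \<bullet> v" "0 < v \<bullet> (A *v v)"
        using that assms by (auto simp: SPD_def)
      then show ?thesis
        unfolding * using \<open>0 \<le> s\<close> \<open>s \<le> 1\<close>
        by (cases "s = 0") (auto intro!: add_nonneg_pos)
    qed
    moreover have "transpose (B s) = B s"
      using assms by (simp add: B_def SPD_def Sym_def transpose_def mat_def vec_eq_iff)
    ultimately show ?thesis
      by (simp add: SPD_def Sym_def)
  qed
  have nz: "det (B s) \<noteq> 0" if "0 \<le> s" "s \<le> 1" for s
    using SPD_inv_left[OF B[OF that]] by (metis det_mul det_I mult_zero_right zero_neq_one)
  have "continuous_on {0..1} (\<lambda>s. det (B s))"
    unfolding det_def B_def by (intro continuous_intros)
  moreover assume "\<not> 0 < det A"
  then have "det (B 1) \<le> 0" "0 \<le> det (B 0)"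
    by (auto simp: B_def)
  ultimately obtain s where "0 \<le> s" "s \<le> 1" "det (B s) = 0"
    using IVT2'[of "\<lambda>s. det (B s)" 1 0 0] by auto
  with nz show False
    by blast
qed

lemma Sym_eqI:
  fixes A B :: "real^'d^'d"
  assumes "A \<in> Sym" "B \<in> Sym" and eq: "\<And>v. v \<bullet> (A *v v) = v \<bullet> (B *v v)"
  shows "A = B"
proof -
  have sym: "u \<bullet> (C *v v) = v \<bullet> (C *v u)" if "C \<in> Sym" for C :: "real^'d^'d" and u v
  proof -
    have "u \<bullet> (C *v v) = (u v* C) \<bullet> v"
      by (simp add: dot_lmul_matrix)
    also have "u v* C = transpose C *v u"
      by simp
    also have "transpose C = C"
      using that by (simp add: Sym_def)
    finally show ?thesis
      by (simp add: inner_commute)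
  qed
  have "u \<bullet> (A *v v) = u \<bullet> (B *v v)" for u v
    using eq[of "u + v"] eq[of u] eq[of v] sym[OF assms(1), of u v] sym[OF assms(2), of u v]
    by (simp add: matrix_vector_right_distrib inner_add_left inner_add_right)
  then have "A *v v = B *v v" for v
    by (metis vector_eq_ldot)
  then show ?thesis
    by (simp add: matrix_eq)
qed

lemma inj_on_gaussian: "inj_on gaussian gauss_manifold"
proof (rule inj_onI)
  fix p q :: "'d::finite gpoint"
  assume pq: "p \<in> gauss_manifold" "q \<in> gauss_manifold" and eq: "gaussian p = gaussian q"
  define c :: "'d gpoint \<Rightarrow> real" where "c p = 1 / sqrt ((2 * pi) ^ CARD('d) * det (snd p))" for p
  define Q :: "'d gpoint \<Rightarrow> real^'d \<Rightarrow> real"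
    where "Q p x = (x - fst p) \<bullet> (matrix_inv (snd p) *v (x - fst p)) / 2" for p x
  have dens: "gauss_density p x = exp (- Q p x) * c p" for p x
    by (simp add: gauss_density_def c_def Q_def)
  have cont: "continuous_on UNIV (gauss_density p)" for p :: "'d gpoint"
    unfolding dens Q_def
    by (intro continuous_intros linear_continuous_on matrix_vector_mul_bounded_linear
        continuous_on_compose2[OF linear_continuous_on[OF matrix_vector_mul_bounded_linear]]) auto
  have c: "0 < c p" if "p \<in> gauss_manifold" for p
    using SPD_det_pos[of "snd p"] that by (auto simp: c_def gauss_manifold_def)
  have Qpos: "0 < Q p x" if "p \<in> gauss_manifold" "x \<noteq> fst p" for p x
    using SPD_matrix_inv_in[of "snd p"] that by (auto simp: Q_def gauss_manifold_def SPD_def)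
  have meas: "gauss_density p \<in> borel_measurable borel" for p :: "'d gpoint"
    by (intro borel_measurable_continuous_onI cont)
  have "AE x in lborel. ennreal (gauss_density p x) = ennreal (gauss_density q x)"
    using eq meas[of p] meas[of q] unfolding gaussian_def
    by (subst sigma_finite_measure.density_unique_iff[OF sigma_finite_lborel, symmetric]) auto
  then have "AE x in lborel. gauss_density p x = gauss_density q x"
    by (rule AE_mp) (use c[OF pq(1)] c[OF pq(2)] in \<open>auto simp: dens intro!: AE_I2\<close>)
  moreover have op: "open {x. gauss_density p x \<noteq> gauss_density q x}"
    using cont by (intro open_Collect_neq)
  ultimately have "{x. gauss_density p x \<noteq> gauss_density q x} \<in> null_sets lborel"
    by (subst (asm) AE_iff_null) (auto simp: space_lborel)
  then have "negligible {x. gauss_density p x \<noteq> gauss_density q x}"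
    by (simp add: negligible_iff_null_sets null_sets_completionI)
  then have deq: "gauss_density p x = gauss_density q x" for x
    using op open_not_negligible by blast
  have "fst p = fst q"
  proof (rule ccontr)
    assume ne: "fst p \<noteq> fst q"
    have "c p < c q"
      using deq[of "fst p"] Qpos[OF pq(2) ne] c[OF pq(2)] by (simp add: dens Q_def[of p])
    moreover have "c q < c p"
      using deq[of "fst q", symmetric] Qpos[OF pq(1) ne[symmetric]] c[OF pq(1)]
      by (simp add: dens Q_def[of q])
    ultimately show False by simp
  qed
  moreover have "snd p = snd q"
  proof -
    have "c p = c q"
      using deq[of "fst p"] \<open>fst p = fst q\<close> by (simp add: dens Q_def)
    then have Q: "Q p x = Q q x" for x
      using deq[of x] c[OF pq(1)] by (simp add: dens)
    have "v \<bullet> (matrix_inv (snd p) *v v) = v \<bullet> (matrix_inv (snd q) *v v)" for v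
      using Q[of "v + fst p"] \<open>fst p = fst q\<close> by (simp add: Q_def)
    moreover have SPD: "snd p \<in> SPD" "snd q \<in> SPD"
      using pq by (auto simp: gauss_manifold_def)
    ultimately have "matrix_inv (snd p) = matrix_inv (snd q)"
      using SPD_matrix_inv_in by (intro Sym_eqI) (auto simp: SPD_def)
    then show ?thesis
      using SPD by (metis SPD_inv_left SPD_inv_right matrix_mul_assoc matrix_mul_lid matrix_mul_rid)
  qed
  ultimately show "p = q"
    by (simp add: prod_eq_iff)
qed

text \<open>The Riemannian metric at \<open>p\<close>; tangent vectors are pairs in \<open>UNIV \<times> Sym\<close>.\<close>

definition gmetric :: "'d::finite gpoint \<Rightarrow> 'd gpoint \<Rightarrow> 'd gpoint \<Rightarrow> real" where
  "gmetric p U V = fst U \<bullet> fst V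
     + trace (matrix_inv (snd p) ** snd U ** matrix_inv (snd p) ** snd V) / 2"

definition gspeed :: "(real \<Rightarrow> 'd::finite gpoint) \<Rightarrow> real \<Rightarrow> real" where
  "gspeed \<gamma> s =
     sqrt (gmetric (\<gamma> s) (vector_derivative \<gamma> (at s)) (vector_derivative \<gamma> (at s)))"

text \<open>
  The induced distance is the infimum of the lengths of piecewise \<open>C\<^sup>1\<close> curves in the
  manifold. The library's piecewise \<open>C\<^sup>1\<close> curves (\<^const>\<open>valid_path\<close>) need not have
  bounded velocity near a break point, so that their length may be infinite; the integrability
  condition discards these, for which the value \<open>0\<close> of \<^const>\<open>integral\<close> is meaningless.
\<close>

definition gcurves :: "'d::finite gpoint \<Rightarrow> 'd gpoint \<Rightarrow> (real \<Rightarrow> 'd gpoint) set" where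
  "gcurves p q = {\<gamma>. valid_path \<gamma> \<and> path_image \<gamma> \<subseteq> gauss_manifold \<and>
     pathstart \<gamma> = p \<and> pathfinish \<gamma> = q \<and> gspeed \<gamma> integrable_on {0..1}}"

definition gdist :: "'d::finite gpoint \<Rightarrow> 'd gpoint \<Rightarrow> real" where
  "gdist p q = (INF \<gamma>\<in>gcurves p q. integral {0..1} (gspeed \<gamma>))"

text \<open>The Borel \<open>\<sigma>\<close>-algebra of the manifold topology.\<close>

definition gauss_borel :: "'d::finite gpoint measure" where
  "gauss_borel = restrict_space borel gauss_manifold"


section \<open>Barycenters\<close>

definition finite_first_moment :: "'d::finite gpoint measure \<Rightarrow> bool" where
  "finite_first_moment q \<longleftrightarrow> prob_space q \<and> sets q = sets gauss_borel \<and>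
     (\<forall>y\<in>gauss_manifold. integrable q (\<lambda>x. gdist y x))"

definition is_barycenter :: "'d::finite gpoint measure \<Rightarrow> 'd gpoint \<Rightarrow> bool" where
  "is_barycenter q z \<longleftrightarrow> (\<forall>y\<in>gauss_manifold.
     is_arg_min (\<lambda>z. \<integral>x. ((gdist z x)\<^sup>2 - (gdist y x)\<^sup>2) \<partial>q) (\<lambda>z. z \<in> gauss_manifold) z)"

definition barycenter :: "'d::finite gpoint measure \<Rightarrow> 'd gpoint" where
  "barycenter q = (THE z. is_barycenter q z)"


section \<open>Paths\<close>

text \<open>
  A path \<open>x\<^sub>0, \<dots>, x\<^sub>t\<close>, i.e. a vector of dimension \<open>(1 + t) d\<close>, is a function on
  \<^typ>\<open>nat\<close> that is \<^const>\<open>undefined\<close> beyond \<open>t\<close>; \<open>path_dist\<close> is the Euclidean distance.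
\<close>

definition path_space :: "nat \<Rightarrow> (nat \<Rightarrow> real^'d) set" where
  "path_space t = {0..t} \<rightarrow>\<^sub>E UNIV"

definition path_dist :: "nat \<Rightarrow> (nat \<Rightarrow> real^'d) \<Rightarrow> (nat \<Rightarrow> real^'d) \<Rightarrow> real" where
  "path_dist t x y = L2_set (\<lambda>r. norm (x r - y r)) {0..t}"

lemma Metric_space_path_dist: "Metric_space (path_space t) (path_dist t)"
proof
  fix x y z :: "nat \<Rightarrow> real^'d"
  show "0 \<le> path_dist t x y"
    by (simp add: path_dist_def L2_set_nonneg)
  show "path_dist t x y = path_dist t y x"
    by (simp add: path_dist_def norm_minus_commute)
  show "path_dist t x y = 0 \<longleftrightarrow> x = y" if "x \<in> path_space t" "y \<in> path_space t"
  proof -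
    have "path_dist t x y = 0 \<longleftrightarrow> (\<forall>r\<in>{0..t}. x r = y r)"
      by (simp add: path_dist_def L2_set_eq_0_iff)
    also have "\<dots> \<longleftrightarrow> x = y"
      using that PiE_ext unfolding path_space_def by blast
    finally show ?thesis .
  qed
  have "path_dist t x z \<le> L2_set (\<lambda>r. norm (x r - y r) + norm (y r - z r)) {0..t}"
    unfolding path_dist_def
    by (rule L2_set_mono) (use norm_triangle_ineq[of "x r - y r" "y r - z r" for r] in auto)
  also have "\<dots> \<le> path_dist t x y + path_dist t y z"
    unfolding path_dist_def by (rule L2_set_triangle_ineq)
  finally show "path_dist t x z \<le> path_dist t x y + path_dist t y z" .
qed


section \<open>The Volterra setting\<close>

definition volterra_kernel :: "(nat \<Rightarrow> nat \<Rightarrow> real) \<Rightarrow> bool" where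
  "volterra_kernel \<kappa> \<longleftrightarrow>
     (\<forall>t. \<forall>r\<le>t. 0 \<le> \<kappa> t r \<and> \<kappa> t r \<le> 1) \<and>
     (\<forall>t. 0 < (\<Sum>r=0..t. \<kappa> t r) \<and> (\<Sum>r=0..t. \<kappa> t r) \<le> 1) \<and>
     (\<forall>t>0. \<kappa> t 0 = 0)"

definition drift ::
  "(nat \<Rightarrow> nat \<Rightarrow> real) \<Rightarrow> (real \<times> (real^'d) \<Rightarrow> real^'d) \<Rightarrow>
   nat \<Rightarrow> (nat \<Rightarrow> real^'d) \<Rightarrow> real^'d" where
  "drift \<kappa> \<mu> t x = (\<Sum>r=0..t. \<kappa> t r *\<^sub>R \<mu> (real t, x r))"

definition log_covariance ::
  "(nat \<Rightarrow> nat \<Rightarrow> real) \<Rightarrow> (real \<times> (real^'d) \<Rightarrow> real^'d^'d) \<Rightarrow>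
   nat \<Rightarrow> (nat \<Rightarrow> real^'d) \<Rightarrow> (nat \<Rightarrow> real^'d^'d) \<Rightarrow> real^'d^'d" where
  "log_covariance \<kappa> \<sigma> t x s = (\<Sum>r=0..t. \<kappa> t r *\<^sub>R (\<sigma> (real t, x r) + s r))"

definition diffusion ::
  "(nat \<Rightarrow> nat \<Rightarrow> real) \<Rightarrow> (real \<times> (real^'d) \<Rightarrow> real^'d^'d) \<Rightarrow>
   nat \<Rightarrow> (nat \<Rightarrow> real^'d) \<Rightarrow> (nat \<Rightarrow> real^'d^'d) \<Rightarrow> real^'d^'d" where
  "diffusion \<kappa> \<sigma> t x s = matexp ((1/2) *\<^sub>R log_covariance \<kappa> \<sigma> t x s)"

locale volterra_setting = prob_space P
  for P :: "'w measure" +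
  fixes L\<mu> L\<sigma> :: real
    and \<mu> :: "real \<times> (real^'d::finite) \<Rightarrow> real^'d"
    and \<sigma> :: "real \<times> (real^'d) \<Rightarrow> real^'d^'d"
    and \<kappa> :: "nat \<Rightarrow> nat \<Rightarrow> real"
    and S :: "nat \<Rightarrow> 'w \<Rightarrow> real^'d^'d"
    and W :: "nat \<Rightarrow> 'w \<Rightarrow> real^'d"
    and x0 :: "real^'d"
    and X :: "nat \<Rightarrow> 'w \<Rightarrow> real^'d"
  assumes lipschitz_\<mu>: "L\<mu>-lipschitz_on UNIV \<mu>"
    and lipschitz_\<sigma>: "L\<sigma>-lipschitz_on UNIV \<sigma>"
    and \<sigma>_Sym: "\<sigma> z \<in> Sym"
    and kernel: "volterra_kernel \<kappa>"
    and S_measurable: "random_variable borel (S n)"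
    and S_Sym: "\<omega> \<in> space P \<Longrightarrow> S n \<omega> \<in> Sym"
    and W_indep: "indep_vars (\<lambda>_. borel) W UNIV"
    and W_gaussian: "distr P borel (W n) = gaussian (0, mat 1)"
    and S_indep_W: "indep_set (sets (vimage_algebra (space P) (\<lambda>\<omega> n. S n \<omega>) (\<Pi>\<^sub>M n\<in>UNIV. borel)))
                              (sets (vimage_algebra (space P) (\<lambda>\<omega> n. W n \<omega>) (\<Pi>\<^sub>M n\<in>UNIV. borel)))"
    and X_0: "\<omega> \<in> space P \<Longrightarrow> X 0 \<omega> = x0"
    and X_Suc: "\<omega> \<in> space P \<Longrightarrow> X (Suc n) \<omega> = X n \<omega> + drift \<kappa> \<mu> n (\<lambda>r. X r \<omega>)
      + diffusion \<kappa> \<sigma> n (\<lambda>r. X r \<omega>) (\<lambda>r. S r \<omega>) *v W n \<omega>"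

definition Psi ::
  "(real \<times> (real^'d) \<Rightarrow> real^'d) \<Rightarrow> (real \<times> (real^'d) \<Rightarrow> real^'d^'d) \<Rightarrow>
   (nat \<Rightarrow> nat \<Rightarrow> real) \<Rightarrow> nat \<Rightarrow> (nat \<Rightarrow> real^'d) \<Rightarrow> (nat \<Rightarrow> real^'d^'d) \<Rightarrow>
   'd::finite gpoint" where
  "Psi \<mu> \<sigma> \<kappa> t x s = (x t + drift \<kappa> \<mu> t x, matexp (log_covariance \<kappa> \<sigma> t x s))"

definition rand_law ::
  "'w measure \<Rightarrow> (real \<times> (real^'d) \<Rightarrow> real^'d) \<Rightarrow> (real \<times> (real^'d) \<Rightarrow> real^'d^'d) \<Rightarrow>
   (nat \<Rightarrow> nat \<Rightarrow> real) \<Rightarrow> (nat \<Rightarrow> 'w \<Rightarrow> real^'d^'d) \<Rightarrow> nat \<Rightarrow> (nat \<Rightarrow> real^'d) \<Rightarrow>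
   'd::finite gpoint measure" where
  "rand_law P \<mu> \<sigma> \<kappa> S t x = distr P gauss_borel (\<lambda>\<omega>. Psi \<mu> \<sigma> \<kappa> t x (\<lambda>r. S r \<omega>))"

definition rand_proj ::
  "'w measure \<Rightarrow> (real \<times> (real^'d) \<Rightarrow> real^'d) \<Rightarrow> (real \<times> (real^'d) \<Rightarrow> real^'d^'d) \<Rightarrow>
   (nat \<Rightarrow> nat \<Rightarrow> real) \<Rightarrow> (nat \<Rightarrow> 'w \<Rightarrow> real^'d^'d) \<Rightarrow> nat \<Rightarrow> (nat \<Rightarrow> real^'d) \<Rightarrow>
   'd::finite gpoint" where
  "rand_proj P \<mu> \<sigma> \<kappa> S t x = barycenter (rand_law P \<mu> \<sigma> \<kappa> S t x)"

end

theory Submission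
  imports Defs
begin

text \<open>
  The Gaussian manifold is the product of a Euclidean space and the cone of positive definite matrices
  with half of its affine-invariant metric. It is complete and nonpositively curved, and in such a space the
  barycenter is a Lipschitz function of the measure. The random projection is Lipschitz because the
  point \<open>\<Psi>\<close> is a Lipschitz function of the path, uniformly in the random environment.

  \<^bold>\<open>Geometry.\<close> Everything is derived from the matrix logarithm. Let \<open>A\<close> and \<open>B\<close> be positive definite with eigenvalues
  \<open>a\<^sub>i\<close>, \<open>b\<^sub>j\<close> and orthonormal eigenvectors \<open>u\<^sub>i\<close>, \<open>v\<^sub>j\<close>. Then \<open>|log A - log B|\<^sup>2\<close> and
  \<open>chord A B = trace (A\<^sup>-\<^sup>1 (B - A) B\<^sup>-\<^sup>1 (B - A))\<close> are the sums of
  \<open>(log a\<^sub>i - log b\<^sub>j)\<^sup>2\<close> and of \<open>(b\<^sub>j - a\<^sub>i)\<^sup>2 / (a\<^sub>i b\<^sub>j)\<close> with the same weights \<open>(u\<^sub>i \<bullet> v\<^sub>j)\<^sup>2\<close>, and the inequality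
  \<open>|s| \<le> |sinh s|\<close> makes the first at most the second. As the chord is infinitesimally the squared length,
  the logarithm does not lengthen curves. As the chord is invariant under congruence, the same holds for all the charts
  \<open>log (H A H\<^sup>T)\<close> (\<open>log_chart_le_gdist\<close>). Two given points are diagonalized by a single congruence, and in that
  chart the straight segment attains the bound (\<open>gdist_eq_log_chart\<close>). So the distance is the maximum over the charts of the
  Euclidean distance. In the chart centered at the midpoint of two points the parallelogram law
  becomes the CN inequality (\<open>gauss_dist_CN\<close>); on bounded sets the logarithm is bi-Lipschitz, which yields
  completeness.

  \<^bold>\<open>Barycenters.\<close> In a complete space with the CN inequality the mean squared distance
  to a random point is uniformly convex, hence has a unique minimizer (\<open>ex_minimizes_spread\<close>,
  \<open>minimizes_spread_unique\<close>). For two random points \<open>f\<close>, \<open>g\<close> with minimizers \<open>a\<close>, \<open>b\<close>, adding the two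
  convexity estimates bounds \<open>d(a,b)\<^sup>2\<close> by the expectation of
  \<open>d(a,g)\<^sup>2 + d(b,f)\<^sup>2 - d(a,f)\<^sup>2 - d(b,g)\<^sup>2\<close>, the analogue of an inner product of the displacements. A
  Cauchy-Schwarz inequality for it (\<open>quad_le\<close>), obtained by repeated halving, bounds
  it by \<open>3 d(a,b) d(f,g)\<close>, and so \<open>d(a,b)\<close> is at most three times the supremum of \<open>d(f,g)\<close>
  (\<open>minimizes_spread_Lipschitz\<close>).

  \<^bold>\<open>Volterra model.\<close> The log-covariance is almost surely bounded by \<open>M + R\<close>, so the law of \<open>\<Psi>\<close> is concentrated on a bounded set,
  and \<open>\<Psi>\<close> is Lipschitz in the path with a constant that involves only the Lipschitz constants
  of the coefficients and \<open>cosh (M + R)\<close> (\<open>Psi_Lipschitz\<close>).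
\<close>

section \<open>Diagonal matrices and matrix products\<close>

definition diag_mat :: "('n \<Rightarrow> real) \<Rightarrow> real^'n^'n" where
  "diag_mat x = (\<chi> i j. if i = j then x i else 0)"

lemma diag_mat_mult_left: "(diag_mat x ** A) $ i $ j = x i * A $ i $ j"
  for A :: "real^'m^'n"
proof -
  have "(diag_mat x ** A) $ i $ j = (\<Sum>k\<in>UNIV. if i = k then x i * A $ k $ j else 0)"
    unfolding diag_mat_def matrix_matrix_mult_def by (simp add: if_distrib if_distribR cong: if_cong)
  then show ?thesis by simp
qed

lemma diag_mat_mult_right: "(A ** diag_mat x) $ i $ j = A $ i $ j * x j"
  for A :: "real^'n^'m"
proof -
  have "(A ** diag_mat x) $ i $ j = (\<Sum>k\<in>UNIV. if k = j then A $ i $ k * x j else 0)"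
    unfolding diag_mat_def matrix_matrix_mult_def by (simp add: if_distrib if_distribR cong: if_cong)
  then show ?thesis by simp
qed

lemma diag_mat_mult: "diag_mat x ** diag_mat y = diag_mat (\<lambda>i. x i * y i)"
  by (simp add: vec_eq_iff diag_mat_mult_left) (simp add: diag_mat_def)

lemma transpose_diag_mat [simp]: "transpose (diag_mat x) = diag_mat x"
  by (simp add: vec_eq_iff transpose_def diag_mat_def)

lemma diag_mat_1: "diag_mat (\<lambda>_. 1) = mat 1"
  by (simp add: vec_eq_iff diag_mat_def mat_def)

lemma trace_diag_mat: "trace (diag_mat x) = (\<Sum>i\<in>UNIV. x i)"
  by (simp add: trace_def diag_mat_def)

lemma norm_matrix_power2: "(norm A)\<^sup>2 = (\<Sum>i\<in>UNIV. \<Sum>j\<in>UNIV. (A $ i $ j)\<^sup>2)"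
  for A :: "real^'m^'n"
  by (simp add: norm_vec_def L2_set_def sum_nonneg)

lemma norm_matrix_power2_trace: "(norm A)\<^sup>2 = trace (A ** transpose A)"
  for A :: "real^'m^'n"
  unfolding norm_matrix_power2
  by (simp add: trace_def matrix_matrix_mult_def transpose_def power2_eq_square)

lemma bounded_bilinear_matrix_mult:
  "bounded_bilinear ((**) :: real^'m^'n \<Rightarrow> real^'k^'m \<Rightarrow> real^'k^'n)"
  unfolding bilinear_conv_bounded_bilinear[symmetric] bilinear_def linear_iff
  by (auto simp: vec_eq_iff matrix_matrix_mult_def sum.distrib sum_distrib_left algebra_simps)

lemmas matrix_diff_ldistrib = bounded_bilinear.diff_right[OF bounded_bilinear_matrix_mult]
  and matrix_diff_rdistrib = bounded_bilinear.diff_left[OF bounded_bilinear_matrix_mult]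

lemmas matrix_mult_scaleR_left = bounded_bilinear.scaleR_left[OF bounded_bilinear_matrix_mult]
  and matrix_mult_scaleR_right = bounded_bilinear.scaleR_right[OF bounded_bilinear_matrix_mult]

lemma orthogonal_matrixD:
  assumes "orthogonal_matrix U"
  shows "transpose U ** U = mat 1" "U ** transpose U = mat 1"
  using assms by (simp_all add: orthogonal_matrix_def)

lemma mult_cancel_middle:
  fixes C D X Y :: "real^'n^'n"
  assumes "C ** D = mat 1"
  shows "X ** C ** (D ** Y) = X ** Y"
  by (metis assms matrix_mul_assoc matrix_mul_rid)

section \<open>The spectral theorem\<close>

text \<open>
  The spectral theorem by induction on the dimension of an invariant subspace \<open>V\<close>: the quadratic form
  \<open>q v = v \<bullet> (A *v v)\<close> attains its maximum on the unit sphere of \<open>V\<close>, every maximizer is an eigenvector,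
  and its orthogonal complement in \<open>V\<close> is again invariant because \<open>A\<close> is symmetric.
\<close>

lemma symmetric_eigenbasis_on_invariant_subspace:
  fixes A :: "real^'n^'n" and V :: "(real^'n) set"
  assumes "A \<in> Sym" "subspace V" "\<And>v. v \<in> V \<Longrightarrow> A *v v \<in> V"
  shows "\<exists>B\<subseteq>V. pairwise orthogonal B \<and> (\<forall>b\<in>B. norm b = 1) \<and> span B = V \<and>
    (\<forall>b\<in>B. \<exists>c. A *v b = c *\<^sub>R b)"
  using assms(2,3)
proof (induction "dim V" arbitrary: V rule: less_induct)
  case (less V)
  have sym: "u \<bullet> (A *v v) = (A *v u) \<bullet> v" for u v
    using \<open>A \<in> Sym\<close> dot_lmul_matrix[of u A v] transpose_matrix_vector[of A u]
    by (simp add: Sym_def)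
  show ?case
  proof (cases "V = {0}")
    case True
    then show ?thesis by (intro exI[of _ "{}"]) auto
  next
    case False
    define q where "q v = v \<bullet> (A *v v)" for v
    define K where "K = V \<inter> sphere 0 1"
    obtain v0 where v0: "v0 \<in> V" "v0 \<noteq> 0"
      using False less.prems(1) subspace_0 by blast
    have "(1 / norm v0) *\<^sub>R v0 \<in> K"
      using v0 less.prems(1) by (simp add: K_def subspace_scale)
    moreover have "compact K"
      unfolding K_def using closed_subspace[OF less.prems(1)] by (simp add: closed_Int_compact)
    moreover have "continuous_on K q"
      unfolding q_def
      by (intro continuous_intros linear_continuous_on matrix_vector_mul_bounded_linear)
    ultimately obtain v where vK: "v \<in> K" and vmax: "\<And>u. u \<in> K \<Longrightarrow> q u \<le> q v"
      using continuous_attains_sup[of K q] by blast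
    have v: "v \<in> V" "norm v = 1" using vK by (auto simp: K_def)
    then have vv: "v \<bullet> v = 1" by (simp add: norm_eq_1)
    have qle: "q u \<le> q v * (u \<bullet> u)" if "u \<in> V" for u
    proof (cases "u = 0")
      case True then show ?thesis by (simp add: q_def)
    next
      case False
      have "q ((1 / norm u) *\<^sub>R u) \<le> q v"
        using that less.prems(1) False by (intro vmax) (simp add: K_def subspace_scale)
      moreover have "q ((1 / norm u) *\<^sub>R u) = q u / (u \<bullet> u)"
        by (simp add: q_def matrix_vector_mult_scaleR dot_square_norm power2_eq_square)
      ultimately show ?thesis using False by (simp add: field_simps)
    qed
    define w where "w = A *v v - q v *\<^sub>R v"
    have wV: "w \<in> V" unfolding w_def
      using v less.prems by (simp add: subspace_diff subspace_scale)
    have "w \<bullet> w = 0"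
    proof (rule ccontr)
      assume ne: "w \<bullet> w \<noteq> 0"
      have wv: "w \<bullet> v = 0"
        by (simp add: w_def inner_diff_left inner_diff_right vv q_def inner_commute)
      define c where "c = q v * (w \<bullet> w) - q w"
      \<comment> \<open>The polynomial \<open>q (v + e w) - q v |v + e w|\<^sup>2\<close> in \<open>e\<close> is nonpositive and vanishes at \<open>e = 0\<close>,
        but its slope there is \<open>2 (w \<bullet> w)\<close>.\<close>
      have step: "2 * e * (w \<bullet> w) \<le> e\<^sup>2 * c" for e
      proof -
        have "v + e *\<^sub>R w \<in> V" using v wV less.prems(1) by (simp add: subspace_add subspace_scale)
        from qle[OF this] have "q (v + e *\<^sub>R w) \<le> q v * ((v + e *\<^sub>R w) \<bullet> (v + e *\<^sub>R w))" .
        moreover have "q (v + e *\<^sub>R w) = q v + 2 * e * (w \<bullet> (A *v v)) + e\<^sup>2 * q w"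
          unfolding q_def using sym[of v w]
          by (simp add: matrix_vector_right_distrib matrix_vector_mult_scaleR inner_add_left
              inner_add_right power2_eq_square algebra_simps inner_commute)
        moreover have "(v + e *\<^sub>R w) \<bullet> (v + e *\<^sub>R w) = 1 + e\<^sup>2 * (w \<bullet> w)"
          using wv vv by (simp add: inner_add_left inner_add_right power2_eq_square inner_commute)
        moreover have "w \<bullet> (A *v v) = w \<bullet> w"
        proof -
          have "w \<bullet> w = w \<bullet> (A *v v) - q v * (w \<bullet> v)"
            by (subst (2) w_def) (simp add: inner_diff_right)
          with wv show ?thesis by simp
        qed
        ultimately have "q v + 2 * e * (w \<bullet> w) + e\<^sup>2 * q w \<le> q v * (1 + e\<^sup>2 * (w \<bullet> w))"
          by metis
        then show ?thesis by (simp add: c_def algebra_simps)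
      qed
      have pos: "w \<bullet> w > 0" using ne by (simp add: less_le)
      define e where "e = (w \<bullet> w) / (\<bar>c\<bar> + 1)"
      have e: "e > 0" "e * \<bar>c\<bar> \<le> w \<bullet> w"
        using pos by (auto simp: e_def divide_simps algebra_simps)
      have "2 * e * (w \<bullet> w) \<le> e * (e * \<bar>c\<bar>)"
        using step[of e] mult_left_mono[of c "\<bar>c\<bar>" "e\<^sup>2", OF abs_ge_self zero_le_power2]
        unfolding power2_eq_square mult.assoc by linarith
      also have "\<dots> \<le> e * (w \<bullet> w)" using e by (intro mult_left_mono) auto
      finally show False using e pos by (simp add: mult.assoc)
    qed
    then have eig: "A *v v = q v *\<^sub>R v" by (simp add: w_def)
    define V' where "V' = {u \<in> V. v \<bullet> u = 0}"
    have sub': "subspace V'"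
      using less.prems(1) by (auto simp: V'_def subspace_def inner_add_right)
    have inv': "A *v u \<in> V'" if "u \<in> V'" for u
      using that less.prems(2) eig by (auto simp: V'_def sym inner_commute)
    have "v \<notin> V'" using vv by (simp add: V'_def)
    moreover have "V' \<subseteq> V" by (auto simp: V'_def)
    ultimately have "V' \<subset> V" using v by blast
    then have "dim V' < dim V"
      using sub' less.prems(1) by (metis dim_psubset span_eq_iff)
    from less.hyps[OF this sub' inv'] obtain B where B: "B \<subseteq> V'" "pairwise orthogonal B"
      "\<forall>b\<in>B. norm b = 1" "span B = V'" "\<forall>b\<in>B. \<exists>c. A *v b = c *\<^sub>R b" by blast
    have "span (insert v B) = V"
    proof
      show "span (insert v B) \<subseteq> V"
        using B(1) v less.prems(1) by (intro span_minimal) (auto simp: V'_def)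
      show "V \<subseteq> span (insert v B)"
      proof
        fix u assume u: "u \<in> V"
        have "u - (v \<bullet> u) *\<^sub>R v \<in> V'"
          using u v less.prems(1) by (auto simp: V'_def subspace_diff subspace_scale inner_diff_right vv)
        then show "u \<in> span (insert v B)" using B(4) by (auto simp: span_insert)
      qed
    qed
    moreover have "pairwise orthogonal (insert v B)"
      using B(1,2) by (auto simp: pairwise_insert orthogonal_def V'_def inner_commute)
    ultimately show ?thesis
      using B v eig by (intro exI[of _ "insert v B"]) (auto simp: V'_def)
  qed
qed

theorem spectral_theorem:
  fixes A :: "real^'n^'n"
  assumes "A \<in> Sym"
  obtains U x where "orthogonal_matrix U" "A = U ** diag_mat x ** transpose U"
proof -
  obtain B where B: "pairwise orthogonal B" "\<forall>b\<in>B. norm b = 1" "span B = (UNIV :: (real^'n) set)"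
    "\<forall>b\<in>B. \<exists>c. A *v b = c *\<^sub>R b"
    using symmetric_eigenbasis_on_invariant_subspace[OF assms subspace_UNIV] by auto
  have "0 \<notin> B" using B(2) by auto
  then have ind: "independent B" using B(1) pairwise_orthogonal_independent by blast
  have "card B = CARD('n)"
    using dim_eq_card[OF _ ind, of UNIV] B(3) dim_UNIV by (simp add: dim_span)
  moreover have "finite B" using ind by (rule independent_imp_finite)
  ultimately obtain f :: "'n \<Rightarrow> real^'n" where f: "bij_betw f UNIV B"
    using finite_same_card_bij[of "UNIV :: 'n set" B] by auto
  have fB: "f i \<in> B" for i using f by (auto simp: bij_betw_def)
  have "\<forall>i. \<exists>c. A *v f i = c *\<^sub>R f i"
    using B(4) fB by blast
  from choice[OF this] obtain x where x: "\<And>i. A *v f i = x i *\<^sub>R f i"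
    by blast
  define U :: "real^'n^'n" where "U = (\<chi> i j. f j $ i)"
  have col: "column j U = f j" for j by (simp add: U_def column_def)
  have orth: "orthogonal_matrix U"
    using B(1,2) fB f by (auto simp: orthogonal_matrix_orthonormal_columns col pairwise_def
        bij_betw_def inj_eq)
  have "(A ** U) $ i $ j = (U ** diag_mat x) $ i $ j" for i j
  proof -
    have "(A ** U) $ i $ j = (A *v f j) $ i"
      by (simp add: matrix_matrix_mult_def matrix_vector_mult_def U_def)
    also have "\<dots> = (U ** diag_mat x) $ i $ j"
      by (simp add: x diag_mat_mult_right U_def)
    finally show ?thesis .
  qed
  then have "A ** U = U ** diag_mat x" by (simp add: vec_eq_iff)
  then have "A = U ** diag_mat x ** transpose U"
    using orthogonal_matrixD[OF orth] by (metis matrix_mul_assoc matrix_mul_rid)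
  with orth that show ?thesis by blast
qed

section \<open>Functions of symmetric matrices\<close>

text \<open>
  For orthogonal \<open>U\<close> this is the symmetric matrix with eigenvalues \<open>x\<close> and eigenvectors the columns of
  \<open>U\<close>. By the spectral theorem every symmetric matrix has this form, and a function of the matrix is
  obtained by applying the function to \<open>x\<close>.
\<close>

definition conj_diag :: "real^'n^'n \<Rightarrow> ('n \<Rightarrow> real) \<Rightarrow> real^'n^'n" where
  "conj_diag U x = U ** diag_mat x ** transpose U"

lemma conj_diag_component: "conj_diag U x $ i $ j = (\<Sum>k\<in>UNIV. U $ i $ k * x k * U $ j $ k)"
proof -
  have "conj_diag U x $ i $ j = (\<Sum>k\<in>UNIV. (U ** diag_mat x) $ i $ k * transpose U $ k $ j)"
    by (simp add: conj_diag_def matrix_matrix_mult_def[of "U ** diag_mat x"])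
  then show ?thesis by (simp add: diag_mat_mult_right transpose_def)
qed

lemma conj_diag_Sym [simp]: "conj_diag U x \<in> Sym"
  by (simp add: Sym_def conj_diag_def matrix_transpose_mul matrix_mul_assoc)

lemma conj_diag_one:
  assumes "orthogonal_matrix U"
  shows "conj_diag U (\<lambda>_. 1) = mat 1"
  using orthogonal_matrixD[OF assms] by (simp add: conj_diag_def diag_mat_1)

lemma conj_diag_mult:
  assumes "orthogonal_matrix U"
  shows "conj_diag U x ** conj_diag U y = conj_diag U (\<lambda>i. x i * y i)"
proof -
  have "conj_diag U x ** conj_diag U y
      = (U ** diag_mat x) ** transpose U ** (U ** (diag_mat y ** transpose U))"
    by (simp add: conj_diag_def matrix_mul_assoc)
  also have "\<dots> = U ** diag_mat x ** (diag_mat y ** transpose U)"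
    by (rule mult_cancel_middle[OF orthogonal_matrixD(1)[OF assms]])
  also have "\<dots> = U ** (diag_mat x ** diag_mat y) ** transpose U"
    by (simp only: matrix_mul_assoc)
  finally show ?thesis by (simp add: diag_mat_mult conj_diag_def)
qed

lemma obtain_conj_diag:
  assumes "A \<in> Sym"
  obtains U x where "orthogonal_matrix U" "A = conj_diag U x"
  using spectral_theorem[OF assms] unfolding conj_diag_def by metis

lemma matrix_inv_eqI:
  fixes A B :: "real^'n^'n"
  assumes "A ** B = mat 1"
  shows "matrix_inv A = B"
proof -
  have BA: "B ** A = mat 1" using assms matrix_left_right_inverse by blast
  then have "\<exists>C. A ** C = mat 1 \<and> C ** A = mat 1" using assms by blast
  from someI_ex[OF this] have "matrix_inv A ** A = mat 1" by (simp add: matrix_inv_def)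
  then show ?thesis using assms by (metis matrix_mul_assoc matrix_mul_lid matrix_mul_rid)
qed

lemma matrix_inv_conj_diag:
  assumes "orthogonal_matrix U" "\<And>i. x i \<noteq> 0"
  shows "matrix_inv (conj_diag U x) = conj_diag U (\<lambda>i. 1 / x i)"
  using assms by (intro matrix_inv_eqI) (simp add: conj_diag_mult conj_diag_one)

lemma diag_mat_SPD:
  assumes "\<And>i. 0 < x i"
  shows "diag_mat x \<in> SPD"
proof -
  have "0 < v \<bullet> (diag_mat x *v v)" if "v \<noteq> 0" for v
  proof -
    obtain i where "v $ i \<noteq> 0" using \<open>v \<noteq> 0\<close> vec_eq_iff[of v 0] by auto
    moreover have "(diag_mat x *v v) $ k = x k * v $ k" for k
    proof -
      have "(diag_mat x *v v) $ k = (\<Sum>j\<in>UNIV. if k = j then x j * v $ j else 0)"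
        unfolding matrix_vector_mult_def diag_mat_def
        by (simp add: if_distrib if_distribR cong: if_cong)
      then show ?thesis by simp
    qed
    ultimately show ?thesis
      using assms unfolding inner_vec_def
      by (intro sum_pos2[of _ i]) (auto simp: mult.left_commute less_imp_le zero_less_mult_iff
          not_square_less_zero linorder_neq_iff)
  qed
  then show ?thesis by (simp add: SPD_def Sym_def)
qed

lemma SPD_congruence:
  fixes A G :: "real^'n^'n"
  assumes "A \<in> SPD" "invertible G"
  shows "G ** A ** transpose G \<in> SPD"
proof -
  have "0 < v \<bullet> ((G ** A ** transpose G) *v v)" if "v \<noteq> 0" for v
  proof -
    have "transpose G *v v \<noteq> 0"
    proof
      assume "transpose G *v v = 0"
      moreover obtain B where "G ** B = mat 1" using assms(2) by (auto simp: invertible_def)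
      then have "transpose B ** transpose G = mat 1"
        by (metis matrix_transpose_mul transpose_mat)
      ultimately have "v = 0"
        by (metis matrix_vector_mul_assoc matrix_vector_mul_lid matrix_vector_mult_0_right)
      with that show False by simp
    qed
    then have "0 < (transpose G *v v) \<bullet> (A *v (transpose G *v v))"
      using assms(1) by (auto simp: SPD_def)
    also have "\<dots> = v \<bullet> (G *v (A *v (transpose G *v v)))"
      using dot_lmul_matrix[of v G] by (simp add: transpose_matrix_vector)
    finally show ?thesis by (simp only: matrix_vector_mul_assoc matrix_mul_assoc)
  qed
  moreover have "transpose A = A" using assms(1) by (simp add: SPD_def Sym_def)
  ultimately show ?thesis
    by (simp add: SPD_def Sym_def matrix_transpose_mul matrix_mul_assoc)
qed

lemma orthogonal_matrix_invertible: "orthogonal_matrix U \<Longrightarrow> invertible (U :: real^'n^'n)"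
  unfolding orthogonal_matrix_def invertible_def by blast

lemma conj_diag_SPD:
  assumes "orthogonal_matrix U" "\<And>i. 0 < x i"
  shows "conj_diag U x \<in> SPD"
  unfolding conj_diag_def
  by (intro SPD_congruence diag_mat_SPD orthogonal_matrix_invertible assms)

lemma SPD_conj_diag_pos:
  assumes "conj_diag U x \<in> SPD" "orthogonal_matrix U"
  shows "0 < x i"
proof -
  have "transpose U ** conj_diag U x ** transpose (transpose U) \<in> SPD"
    using assms by (intro SPD_congruence orthogonal_matrix_invertible) auto
  also have "transpose U ** conj_diag U x ** transpose (transpose U) = diag_mat x"
    using orthogonal_matrixD[OF assms(2)]
    by (simp add: conj_diag_def matrix_mul_assoc) (metis matrix_mul_assoc matrix_mul_rid)
  finally have "diag_mat x \<in> SPD" .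
  then have "0 < axis i 1 \<bullet> (diag_mat x *v axis i (1::real))"
    unfolding SPD_def by (simp add: axis_eq_0_iff)
  also have "axis i 1 \<bullet> (diag_mat x *v axis i (1::real)) = x i"
    by (simp add: inner_axis' matrix_vector_mult_basis column_def diag_mat_def)
  finally show ?thesis .
qed

lemma obtain_SPD_conj_diag:
  assumes "A \<in> SPD"
  obtains U x where "orthogonal_matrix U" "\<And>i. 0 < x i" "A = conj_diag U x"
proof -
  obtain U x where U: "orthogonal_matrix U" "A = conj_diag U x"
    using obtain_conj_diag assms unfolding SPD_def by blast
  with SPD_conj_diag_pos assms that show ?thesis by metis
qed

text \<open>
  The computational heart of the geometry. Expressed from the eigenbasis of one matrix to that of the
  other, \<open>B - A\<close> has the entries \<open>(b j - a i) * w $ i $ j\<close>, where \<open>w\<close> contains the inner products of the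
  eigenvectors. Therefore every quadratic expression of this kind in two noncommuting matrices is a sum
  over pairs of eigenvalues, always with the same nonnegative weights, and inequalities between
  such expressions reduce to inequalities between numbers.
\<close>

lemma trace_conj_diag_diff:
  fixes U V :: "real^'n^'n"
  assumes U: "orthogonal_matrix U" and V: "orthogonal_matrix V"
  defines "w \<equiv> transpose U ** V"
  shows "trace (conj_diag U f ** (conj_diag V b - conj_diag U a) ** conj_diag V g
            ** (conj_diag V b - conj_diag U a))
    = (\<Sum>i\<in>UNIV. \<Sum>j\<in>UNIV. f i * g j * (b j - a i)\<^sup>2 * (w $ i $ j)\<^sup>2)"
proof -
  define N where "N = w ** diag_mat b - diag_mat a ** w"
  have N: "N $ i $ j = (b j - a i) * w $ i $ j" for i j
    by (simp add: N_def diag_mat_mult_left diag_mat_mult_right algebra_simps)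
  note UU = orthogonal_matrixD[OF U] and VV = orthogonal_matrixD[OF V]
  have 1: "conj_diag V b - conj_diag U a = U ** N ** transpose V"
  proof -
    have "U ** (w ** diag_mat b) ** transpose V = conj_diag V b"
      by (simp add: w_def conj_diag_def matrix_mul_assoc UU)
    moreover have "U ** (diag_mat a ** w) ** transpose V = conj_diag U a"
      unfolding w_def conj_diag_def by (metis VV(2) matrix_mul_assoc matrix_mul_rid)
    ultimately show ?thesis
      by (simp add: N_def matrix_diff_ldistrib matrix_diff_rdistrib)
  qed
  have 2: "conj_diag V b - conj_diag U a = V ** transpose N ** transpose U"
  proof -
    have "transpose (conj_diag V b - conj_diag U a) = conj_diag V b - conj_diag U a"
      using conj_diag_Sym[of V b] conj_diag_Sym[of U a]
      by (simp add: Sym_def transpose_def vec_eq_iff)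
    then show ?thesis
      using arg_cong[OF 1, of transpose] by (simp add: matrix_transpose_mul matrix_mul_assoc)
  qed
  let ?P = "diag_mat f ** N ** diag_mat g ** transpose N"
  have "conj_diag U f ** (conj_diag V b - conj_diag U a) ** conj_diag V g
            ** (conj_diag V b - conj_diag U a)
      = conj_diag U f ** (U ** N ** transpose V) ** conj_diag V g ** (V ** transpose N ** transpose U)"
    using 1 2 by simp
  also have "\<dots> = U ** diag_mat f ** transpose U ** (U ** (N ** transpose V)) **
      (V ** (diag_mat g ** transpose V)) ** (V ** (transpose N ** transpose U))"
    by (simp add: conj_diag_def matrix_mul_assoc)
  also have "\<dots> = U ** diag_mat f ** (N ** transpose V) **
      (V ** (diag_mat g ** transpose V)) ** (V ** (transpose N ** transpose U))"
    using UU by (subst mult_cancel_middle) auto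
  also have "\<dots> = U ** diag_mat f ** N ** transpose V **
      (V ** (diag_mat g ** transpose V)) ** (V ** (transpose N ** transpose U))"
    by (simp add: matrix_mul_assoc)
  also have "\<dots> = U ** diag_mat f ** N ** (diag_mat g ** transpose V) ** (V ** (transpose N ** transpose U))"
    using VV by (subst mult_cancel_middle) auto
  also have "\<dots> = U ** diag_mat f ** N ** diag_mat g ** transpose V ** (V ** (transpose N ** transpose U))"
    by (simp add: matrix_mul_assoc)
  also have "\<dots> = U ** diag_mat f ** N ** diag_mat g ** (transpose N ** transpose U)"
    using VV by (subst mult_cancel_middle) auto
  also have "\<dots> = U ** (?P ** transpose U)"
    by (simp add: matrix_mul_assoc)
  finally have "trace (conj_diag U f ** (conj_diag V b - conj_diag U a) ** conj_diag V g
            ** (conj_diag V b - conj_diag U a)) = trace (U ** (?P ** transpose U))"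
    by simp
  also have "\<dots> = trace ?P"
    by (subst trace_mul_sym) (metis UU(1) matrix_mul_assoc matrix_mul_rid)
  also have "\<dots> = (\<Sum>i\<in>UNIV. \<Sum>j\<in>UNIV. (diag_mat f ** N ** diag_mat g) $ i $ j * N $ i $ j)"
    unfolding trace_def matrix_matrix_mult_def[of _ "transpose N"] by (simp add: transpose_def)
  also have "\<dots> = (\<Sum>i\<in>UNIV. \<Sum>j\<in>UNIV. f i * g j * (b j - a i)\<^sup>2 * (w $ i $ j)\<^sup>2)"
    by (simp add: diag_mat_mult_left diag_mat_mult_right N power2_eq_square mult_ac)
  finally show ?thesis .
qed

lemma norm_conj_diag_diff:
  fixes U V :: "real^'n^'n"
  assumes "orthogonal_matrix U" "orthogonal_matrix V"
  shows "(norm (conj_diag U a - conj_diag V b))\<^sup>2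
    = (\<Sum>i\<in>UNIV. \<Sum>j\<in>UNIV. (b j - a i)\<^sup>2 * ((transpose U ** V) $ i $ j)\<^sup>2)"
proof -
  let ?D = "conj_diag V b - conj_diag U a"
  have "transpose ?D = ?D"
    using conj_diag_Sym[of V b] conj_diag_Sym[of U a]
    by (simp add: Sym_def transpose_def vec_eq_iff)
  then have "(norm ?D)\<^sup>2 = trace (conj_diag U (\<lambda>_. 1) ** ?D ** conj_diag V (\<lambda>_. 1) ** ?D)"
    by (simp add: norm_matrix_power2_trace conj_diag_one assms)
  then show ?thesis
    by (simp only: trace_conj_diag_diff[OF assms] norm_minus_commute) simp
qed

lemma norm_conj_diag:
  assumes "orthogonal_matrix U"
  shows "(norm (conj_diag U a))\<^sup>2 = (\<Sum>i\<in>UNIV. (a i)\<^sup>2)"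
proof -
  have "conj_diag U (\<lambda>_. 0) = 0"
    by (simp add: vec_eq_iff conj_diag_component)
  moreover have "(\<Sum>j\<in>UNIV. (0 - a i)\<^sup>2 * (mat 1 $ i $ j)\<^sup>2) = (a i)\<^sup>2" for i
  proof -
    have "(\<Sum>j\<in>UNIV. (0 - a i)\<^sup>2 * ((mat 1 :: real^'a^'a) $ i $ j)\<^sup>2) = (\<Sum>j\<in>UNIV. if i = j then (a i)\<^sup>2 else 0)"
      by (intro sum.cong) (auto simp: mat_def)
    then show ?thesis by simp
  qed
  ultimately show ?thesis
    using norm_conj_diag_diff[OF assms assms, of a "\<lambda>_. 0"] orthogonal_matrixD[OF assms] by simp
qed

lemma abs_le_norm_conj_diag:
  assumes "orthogonal_matrix U"
  shows "\<bar>a i\<bar> \<le> norm (conj_diag U a)"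
proof (rule abs_le_square_iff[THEN iffD2, of _ "norm (conj_diag U a)", unfolded abs_norm_cancel])
  show "(a i)\<^sup>2 \<le> (norm (conj_diag U a))\<^sup>2"
    unfolding norm_conj_diag[OF assms] by (intro member_le_sum) auto
qed

section \<open>Exponential, logarithm and the chord\<close>

lemma matpow_conj_diag:
  assumes "orthogonal_matrix U"
  shows "matpow (conj_diag U x) n = conj_diag U (\<lambda>i. x i ^ n)"
  by (induction n) (simp_all add: conj_diag_one conj_diag_mult assms)

lemma matexp_conj_diag:
  assumes "orthogonal_matrix U"
  shows "matexp (conj_diag U x) = conj_diag U (\<lambda>i. exp (x i))"
proof -
  have "(\<lambda>n. ((1 / fact n) *\<^sub>R matpow (conj_diag U x) n)) sums conj_diag U (\<lambda>i. exp (x i))"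
    unfolding sums_def
  proof (intro vec_tendstoI)
    fix i j
    have "(\<lambda>n. \<Sum>k\<in>UNIV. U $ i $ k * ((x k ^ n) /\<^sub>R fact n) * U $ j $ k) sums
        (\<Sum>k\<in>UNIV. U $ i $ k * exp (x k) * U $ j $ k)"
      by (intro sums_sum sums_mult2 sums_mult exp_converges)
    moreover have "((1 / fact n) *\<^sub>R matpow (conj_diag U x) n) $ i $ j
        = (\<Sum>k\<in>UNIV. U $ i $ k * ((x k ^ n) /\<^sub>R fact n) * U $ j $ k)" for n
      by (simp add: matpow_conj_diag[OF assms] conj_diag_component sum_distrib_left field_simps)
    ultimately show "(\<lambda>n. (\<Sum>k<n. (1 / fact k) *\<^sub>R matpow (conj_diag U x) k) $ i $ j)
        \<longlonglongrightarrow> conj_diag U (\<lambda>i. exp (x i)) $ i $ j"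
      unfolding sums_def conj_diag_component by (simp add: sum_component)
  qed
  then show ?thesis by (simp add: matexp_def sums_iff)
qed

text \<open>
  A discrete version of the squared length of the affine-invariant metric: if \<open>B\<close> tends to \<open>A\<close> along a curve,
  then \<open>chord A B\<close> is to second order \<open>trace (A\<^sup>-\<^sup>1 X A\<^sup>-\<^sup>1 X)\<close> for the displacement \<open>X\<close>. Using both inverses makes it
  symmetric, and makes the comparison with the logarithm below exact rather than asymptotic.
\<close>

definition chord :: "real^'n^'n \<Rightarrow> real^'n^'n \<Rightarrow> real" where
  "chord A B = trace (matrix_inv A ** (B - A) ** matrix_inv B ** (B - A))"

lemma chord_conj_diag:
  fixes U V :: "real^'n^'n"
  assumes "orthogonal_matrix U" "orthogonal_matrix V" "\<And>i. 0 < a i" "\<And>i. 0 < b i"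
  shows "chord (conj_diag U a) (conj_diag V b)
    = (\<Sum>i\<in>UNIV. \<Sum>j\<in>UNIV. (b j - a i)\<^sup>2 / (a i * b j) * ((transpose U ** V) $ i $ j)\<^sup>2)"
proof -
  have nz: "a i \<noteq> 0" "b i \<noteq> 0" for i using assms(3,4)[of i] by auto
  show ?thesis
    unfolding chord_def matrix_inv_conj_diag[OF assms(1) nz(1)] matrix_inv_conj_diag[OF assms(2) nz(2)]
      trace_conj_diag_diff[OF assms(1,2)]
    by (simp add: mult_ac)
qed

lemma matexp_SPD: "X \<in> Sym \<Longrightarrow> matexp X \<in> SPD"
  by (erule obtain_conj_diag) (simp add: matexp_conj_diag conj_diag_SPD)

text \<open>
  The contribution of a pair of eigenvalues \<open>exp x\<close>, \<open>exp y\<close> to the chord; its comparison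
  with \<open>(y - x)\<^sup>2\<close> is a comparison of \<open>sinh\<close> with the identity.
\<close>

lemma exp_diff_square_quotient:
  "(exp y - exp x)\<^sup>2 / (exp x * exp y) = (2 * sinh ((y - x) / 2))\<^sup>2" for x y :: real
proof -
  have e: "exp x = exp (x/2) * exp (x/2)" "exp y = exp (y/2) * exp (y/2)"
    by (simp_all flip: exp_add)
  have "2 * sinh ((y - x) / 2) = exp (y/2) / exp (x/2) - exp (x/2) / exp (y/2)"
    by (simp add: sinh_def diff_divide_distrib exp_diff exp_minus)
  moreover have "(b * b - a * a)\<^sup>2 / (a * a * (b * b)) = (b / a - a / b)\<^sup>2"
    if "a > 0" "b > 0" for a b :: real
    using that by (simp add: field_simps power2_eq_square)
  ultimately show ?thesis
    unfolding e(1) e(2) by simp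
qed

lemma abs_le_abs_sinh: "\<bar>s\<bar> \<le> \<bar>sinh s\<bar>" for s :: real
proof -
  have *: "s \<le> sinh s" if "s \<ge> 0" for s :: real
  proof -
    have "(\<lambda>s. sinh s - s) 0 \<le> (\<lambda>s. sinh s - s) s"
    proof (rule DERIV_nonneg_imp_nondecreasing[OF that])
      fix x :: real
      show "\<exists>y. ((\<lambda>s. sinh s - s) has_real_derivative y) (at x) \<and> 0 \<le> y"
        by (rule exI[of _ "cosh x - 1"]) (auto intro!: derivative_eq_intros simp: cosh_real_ge_1)
    qed
    then show ?thesis by simp
  qed
  show ?thesis using *[of s] *[of "-s"] by (cases "s \<ge> 0") auto
qed

lemma abs_sinh_le: "\<bar>sinh s\<bar> \<le> cosh r * \<bar>s\<bar>" if "\<bar>s\<bar> \<le> r" for s r :: real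
proof -
  have *: "sinh s \<le> cosh r * s" if "s \<ge> 0" "s \<le> r" for s :: real
  proof -
    have "(\<lambda>s. cosh r * s - sinh s) 0 \<le> (\<lambda>s. cosh r * s - sinh s) s"
    proof (rule DERIV_nonneg_imp_nondecreasing[OF that(1)])
      fix x :: real assume "0 \<le> x" "x \<le> s"
      then show "\<exists>y. ((\<lambda>s. cosh r * s - sinh s) has_real_derivative y) (at x) \<and> 0 \<le> y"
        using that(2) by (intro exI[of _ "cosh r - cosh x"])
          (auto intro!: derivative_eq_intros simp: cosh_real_nonneg_le_iff)
    qed
    then show ?thesis by simp
  qed
  show ?thesis using *[of s] *[of "-s"] that by (cases "s \<ge> 0") auto
qed

text \<open>
  The first bound is the exponential metric increasing property, that is, nonpositive curvature in the
  form in which it is used below. The second one shows that the exponential is bi-Lipschitz on bounded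
  sets, which gives completeness, the topology, and the Lipschitz estimate for the Volterra model.
\<close>

lemma chord_matexp_bounds:
  fixes X Y :: "real^'n^'n"
  assumes "X \<in> Sym" "Y \<in> Sym"
  shows norm_diff_le_chord_matexp: "(norm (X - Y))\<^sup>2 \<le> chord (matexp X) (matexp Y)"
    and chord_matexp_le: "norm X \<le> r \<Longrightarrow> norm Y \<le> r \<Longrightarrow>
      chord (matexp X) (matexp Y) \<le> (cosh r)\<^sup>2 * (norm (X - Y))\<^sup>2"
proof -
  obtain U x where U: "orthogonal_matrix U" and X: "X = conj_diag U x"
    using obtain_conj_diag assms(1) by blast
  obtain V y where V: "orthogonal_matrix V" and Y: "Y = conj_diag V y"
    using obtain_conj_diag assms(2) by blast
  let ?w = "\<lambda>i j. ((transpose U ** V) $ i $ j)\<^sup>2"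
  have ch: "chord (matexp X) (matexp Y)
      = (\<Sum>i\<in>UNIV. \<Sum>j\<in>UNIV. (2 * sinh ((y j - x i) / 2))\<^sup>2 * ?w i j)"
    unfolding X Y matexp_conj_diag[OF U] matexp_conj_diag[OF V]
    by (subst chord_conj_diag[OF U V]) (auto simp: exp_diff_square_quotient simp del: power_mult_distrib)
  have nr: "(norm (X - Y))\<^sup>2 = (\<Sum>i\<in>UNIV. \<Sum>j\<in>UNIV. (y j - x i)\<^sup>2 * ?w i j)"
    unfolding X Y by (rule norm_conj_diag_diff[OF U V])
  show "(norm (X - Y))\<^sup>2 \<le> chord (matexp X) (matexp Y)"
    unfolding ch nr
  proof (intro sum_mono mult_right_mono)
    fix i j
    show "(y j - x i)\<^sup>2 \<le> (2 * sinh ((y j - x i) / 2))\<^sup>2"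
      using abs_le_abs_sinh[of "(y j - x i) / 2"] by (intro abs_le_square_iff[THEN iffD1]) auto
  qed auto
  show "chord (matexp X) (matexp Y) \<le> (cosh r)\<^sup>2 * (norm (X - Y))\<^sup>2" if "norm X \<le> r" "norm Y \<le> r"
    unfolding ch nr sum_distrib_left mult.assoc[symmetric]
  proof (intro sum_mono mult_right_mono)
    fix i j
    have "\<bar>x i\<bar> \<le> r" "\<bar>y j\<bar> \<le> r"
      using abs_le_norm_conj_diag[OF U, of x i] abs_le_norm_conj_diag[OF V, of y j] that X Y by auto
    then have "\<bar>(y j - x i) / 2\<bar> \<le> r" by auto
    from abs_sinh_le[OF this] have "\<bar>2 * sinh ((y j - x i) / 2)\<bar> \<le> \<bar>cosh r * (y j - x i)\<bar>"
      by (simp add: abs_mult)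
    then show "(2 * sinh ((y j - x i) / 2))\<^sup>2 \<le> (cosh r)\<^sup>2 * (y j - x i)\<^sup>2"
      unfolding abs_le_square_iff by (simp add: power_mult_distrib)
  qed auto
qed

lemma chord_self [simp]: "chord A A = 0"
  by (simp add: chord_def trace_def matrix_matrix_mult_def)

lemma bij_betw_matexp: "bij_betw matexp Sym SPD"
  unfolding bij_betw_def
proof
  show "inj_on matexp Sym"
  proof (rule inj_onI)
    fix X Y :: "real^'n^'n"
    assume "X \<in> Sym" "Y \<in> Sym" "matexp X = matexp Y"
    then show "X = Y" using norm_diff_le_chord_matexp[of X Y] by simp
  qed
  show "matexp ` Sym = SPD"
  proof
    show "matexp ` Sym \<subseteq> SPD" using matexp_SPD by auto
    show "SPD \<subseteq> matexp ` Sym"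
    proof
      fix A :: "real^'n^'n" assume "A \<in> SPD"
      then obtain U x where U: "orthogonal_matrix U" "\<And>i. 0 < x i" "A = conj_diag U x"
        using obtain_SPD_conj_diag by blast
      then have "A = matexp (conj_diag U (\<lambda>i. ln (x i)))"
        by (simp add: matexp_conj_diag)
      then show "A \<in> matexp ` Sym" by auto
    qed
  qed
qed

definition matlog :: "real^'n^'n \<Rightarrow> real^'n^'n" where
  "matlog = the_inv_into Sym matexp"

lemma matlog_matexp: "X \<in> Sym \<Longrightarrow> matlog (matexp X) = X"
  unfolding matlog_def by (rule the_inv_into_f_f[OF bij_betw_imp_inj_on[OF bij_betw_matexp]])

lemma matexp_matlog: "A \<in> SPD \<Longrightarrow> matexp (matlog A) = A"
  unfolding matlog_def by (rule f_the_inv_into_f_bij_betw[OF bij_betw_matexp]) auto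

lemma matlog_Sym: "A \<in> SPD \<Longrightarrow> matlog A \<in> Sym"
  unfolding matlog_def by (rule bij_betwE[OF bij_betw_the_inv_into[OF bij_betw_matexp], rule_format])

lemma matlog_conj_diag:
  assumes "orthogonal_matrix U" "\<And>i. 0 < x i"
  shows "matlog (conj_diag U x) = conj_diag U (\<lambda>i. ln (x i))"
proof -
  have "conj_diag U x = matexp (conj_diag U (\<lambda>i. ln (x i)))"
    using assms by (simp add: matexp_conj_diag)
  then show ?thesis by (simp add: matlog_matexp)
qed

lemma norm_matlog_diff_le_chord:
  assumes "A \<in> SPD" "B \<in> SPD"
  shows "(norm (matlog A - matlog B))\<^sup>2 \<le> chord A B"
  using norm_diff_le_chord_matexp[OF matlog_Sym[OF assms(1)] matlog_Sym[OF assms(2)]]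
  by (simp only: matexp_matlog assms)

lemma trace_congruence_cancel:
  fixes G H A :: "real^'n^'n"
  assumes "H ** G = mat 1"
  shows "trace (H ** A ** G) = trace A"
proof -
  have "trace (H ** A ** G) = trace (G ** H ** A)"
    using trace_mul_sym[of "H ** A" G] by (simp only: matrix_mul_assoc)
  then show ?thesis
    using assms by (simp add: matrix_left_right_inverse)
qed

lemma matrix_inv_congruence:
  fixes A G :: "real^'n^'n"
  assumes "A \<in> SPD" "G ** H = mat 1"
  shows "matrix_inv (G ** A ** transpose G) = transpose H ** matrix_inv A ** H"
proof (rule matrix_inv_eqI)
  have "transpose H ** transpose G = mat 1"
    using assms(2) by (metis matrix_transpose_mul transpose_mat)
  then have 1: "transpose G ** transpose H = mat 1"
    by (simp add: matrix_left_right_inverse)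
  have "G ** A ** transpose G ** (transpose H ** matrix_inv A ** H)
      = (G ** A) ** transpose G ** (transpose H ** (matrix_inv A ** H))"
    by (simp add: matrix_mul_assoc)
  also have "\<dots> = G ** A ** (matrix_inv A ** H)"
    by (rule mult_cancel_middle[OF 1])
  also have "\<dots> = G ** H"
    by (rule mult_cancel_middle) (rule SPD_inv_right[OF assms(1)])
  finally show "G ** A ** transpose G ** (transpose H ** matrix_inv A ** H) = mat 1"
    using assms(2) by simp
qed

text \<open>
  Congruences \<open>A \<mapsto> G ** A ** transpose G\<close> are isometries of the affine-invariant metric. With two base points \<open>A\<close>,
  \<open>B\<close> the statement covers the metric and the chord at once.
\<close>

lemma trace_tangent_congruence:
  fixes A B G X Y :: "real^'n^'n"
  assumes "A \<in> SPD" "B \<in> SPD" "invertible G"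
  shows "trace (matrix_inv (G ** A ** transpose G) ** (G ** X ** transpose G)
      ** matrix_inv (G ** B ** transpose G) ** (G ** Y ** transpose G))
    = trace (matrix_inv A ** X ** matrix_inv B ** Y)"
proof -
  obtain H where GH: "G ** H = mat 1" and HG: "H ** G = mat 1"
    using assms(3) by (auto simp: invertible_def)
  have t: "transpose G ** transpose H = mat 1" "transpose H ** transpose G = mat 1"
    using arg_cong[OF GH, of transpose] arg_cong[OF HG, of transpose]
    by (simp_all only: matrix_transpose_mul transpose_mat)
  have "matrix_inv (G ** A ** transpose G) ** (G ** X ** transpose G)
      ** matrix_inv (G ** B ** transpose G) ** (G ** Y ** transpose G)
    = transpose H ** matrix_inv A ** H ** (G ** (X ** transpose G)) **
        (transpose H ** (matrix_inv B ** H)) ** (G ** (Y ** transpose G))"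
    by (simp add: matrix_inv_congruence[OF _ GH] assms matrix_mul_assoc)
  also have "\<dots> = transpose H ** matrix_inv A ** (X ** transpose G) **
        (transpose H ** (matrix_inv B ** H)) ** (G ** (Y ** transpose G))"
    by (simp only: mult_cancel_middle[OF HG])
  also have "\<dots> = transpose H ** matrix_inv A ** X ** transpose G **
        (transpose H ** (matrix_inv B ** H)) ** (G ** (Y ** transpose G))"
    by (simp only: matrix_mul_assoc)
  also have "\<dots> = transpose H ** matrix_inv A ** X ** (matrix_inv B ** H) ** (G ** (Y ** transpose G))"
    by (simp only: mult_cancel_middle[OF t(1)])
  also have "\<dots> = transpose H ** matrix_inv A ** X ** matrix_inv B ** H ** (G ** (Y ** transpose G))"
    by (simp only: matrix_mul_assoc)
  also have "\<dots> = transpose H ** matrix_inv A ** X ** matrix_inv B ** (Y ** transpose G)"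
    by (simp only: mult_cancel_middle[OF HG])
  also have "\<dots> = transpose H ** (matrix_inv A ** X ** matrix_inv B ** Y) ** transpose G"
    by (simp only: matrix_mul_assoc)
  finally show ?thesis by (simp only: trace_congruence_cancel[OF t(2)])
qed

lemma chord_congruence:
  fixes A B G :: "real^'n^'n"
  assumes "A \<in> SPD" "B \<in> SPD" "invertible G"
  shows "chord (G ** A ** transpose G) (G ** B ** transpose G) = chord A B"
proof -
  have "G ** B ** transpose G - G ** A ** transpose G = G ** (B - A) ** transpose G"
    by (simp add: matrix_diff_ldistrib matrix_diff_rdistrib)
  then show ?thesis
    unfolding chord_def using trace_tangent_congruence[OF assms] by metis
qed

section \<open>Continuity of the matrix inverse\<close>

lemma tendsto_det:
  fixes A :: "real^'n^'n"
  assumes "(f \<longlongrightarrow> A) F"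
  shows "((\<lambda>x. det (f x)) \<longlongrightarrow> det A) F"
  unfolding det_def by (intro tendsto_intros assms)

text \<open>
  By Cramer's rule the entries of the inverse are quotients of determinants, hence continuous.
\<close>

lemma matrix_inv_cramer:
  fixes A :: "real^'n^'n"
  assumes "det A \<noteq> 0"
  shows "matrix_inv A $ k $ l = det (\<chi> i j. if j = k then axis l 1 $ i else A $ i $ j) / det A"
proof -
  obtain B where B: "A ** B = mat 1"
    using assms by (auto simp: invertible_det_nz[symmetric] invertible_def)
  have "A *v (matrix_inv A *v axis l 1) = axis l 1"
    by (simp add: matrix_inv_eqI[OF B] matrix_vector_mul_assoc B)
  then have "matrix_inv A *v axis l 1
      = (\<chi> k. det (\<chi> i j. if j = k then axis l 1 $ i else A $ i $ j) / det A)"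
    using cramer[OF assms] by blast
  then have "(matrix_inv A *v axis l 1) $ k = det (\<chi> i j. if j = k then axis l 1 $ i else A $ i $ j) / det A"
    by simp
  then show ?thesis by (simp add: matrix_vector_mult_basis column_def)
qed

lemma tendsto_matrix_inv:
  fixes A :: "real^'n^'n"
  assumes f: "(f \<longlongrightarrow> A) F" and "det A \<noteq> 0"
  shows "((\<lambda>x. matrix_inv (f x)) \<longlongrightarrow> matrix_inv A) F"
proof (intro vec_tendstoI)
  fix k l
  have ev: "\<forall>\<^sub>F x in F. det (f x) \<noteq> 0"
    using tendsto_det[OF f] assms(2) by (rule tendsto_imp_eventually_ne)
  have "((\<lambda>x. (\<chi> i j. if j = k then axis l 1 $ i else f x $ i $ j) :: real^'n^'n)
      \<longlongrightarrow> (\<chi> i j. if j = k then axis l 1 $ i else A $ i $ j)) F"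
  proof (intro vec_tendstoI)
    fix i j
    show "((\<lambda>x. ((\<chi> i j. if j = k then axis l 1 $ i else f x $ i $ j) :: real^'n^'n) $ i $ j)
      \<longlongrightarrow> ((\<chi> i j. if j = k then axis l 1 $ i else A $ i $ j) :: real^'n^'n) $ i $ j) F"
      using f by (cases "j = k") (auto intro!: tendsto_intros)
  qed
  then have "((\<lambda>x. det (\<chi> i j. if j = k then axis l 1 $ i else f x $ i $ j) / det (f x))
      \<longlongrightarrow> det (\<chi> i j. if j = k then axis l 1 $ i else A $ i $ j) / det A) F"
    by (intro tendsto_divide tendsto_det f assms(2))
  then show "((\<lambda>x. matrix_inv (f x) $ k $ l) \<longlongrightarrow> matrix_inv A $ k $ l) F"
    unfolding matrix_inv_cramer[OF assms(2)]
    by (rule Lim_transform_eventually) (use ev in eventually_elim, simp add: matrix_inv_cramer)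
qed

lemmas tendsto_matrix_mult = bounded_bilinear.tendsto[OF bounded_bilinear_matrix_mult]

lemma tendsto_trace:
  fixes A :: "real^'n^'n"
  assumes "(f \<longlongrightarrow> A) F"
  shows "((\<lambda>x. trace (f x)) \<longlongrightarrow> trace A) F"
  unfolding trace_def by (intro tendsto_intros assms)

section \<open>From a local speed bound to a length bound\<close>

text \<open>
  A mean value inequality for a map that is not known to be differentiable: the matrix logarithm along a
  curve is only controlled by difference quotients. Finitely many exceptional points are allowed,
  since piecewise smooth curves have them; there only continuity is used.
\<close>

lemma norm_diff_le_of_local_bound:
  fixes \<phi> :: "real \<Rightarrow> 'a::real_normed_vector" and J :: "real \<Rightarrow> real"
  assumes "a \<le> b" and \<phi>: "continuous_on {a..b} \<phi>" and J: "continuous_on {a..b} J" and "finite S"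
    and loc: "\<And>t e. t \<in> {a..b} - S \<Longrightarrow> e > 0 \<Longrightarrow>
      \<forall>\<^sub>F s in at t within {a..b}. norm (\<phi> s - \<phi> t) \<le> sgn (s - t) * (J s - J t) + e * \<bar>s - t\<bar>"
  shows "norm (\<phi> b - \<phi> a) \<le> J b - J a"
proof -
  \<comment> \<open>\<open>N\<close> is additive over adjacent intervals and at least 1 on every nondegenerate interval that contains
    a point of \<open>S\<close>, also as an end point. It pays for the oscillation near the exceptional points.\<close>
  define N where "N u v = real (card (S \<inter> {u..<v}) + card (S \<inter> {u<..v}))" for u v
  have N_add: "N u v + N v w = N u w" if "u \<le> v" "v \<le> w" for u v w
  proof -
    have "S \<inter> {u..<w} = (S \<inter> {u..<v}) \<union> (S \<inter> {v..<w})" "S \<inter> {u<..w} = (S \<inter> {u<..v}) \<union> (S \<inter> {v<..w})"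
      using that by auto
    then have "card (S \<inter> {u..<w}) = card (S \<inter> {u..<v}) + card (S \<inter> {v..<w})"
      "card (S \<inter> {u<..w}) = card (S \<inter> {u<..v}) + card (S \<inter> {v<..w})"
      using \<open>finite S\<close> by (auto intro!: card_Un_disjoint)
    then show ?thesis unfolding N_def by simp
  qed
  have N_nonneg: "0 \<le> N u v" for u v by (simp add: N_def)
  have bound: "norm (\<phi> b - \<phi> a) \<le> J b - J a + e * (b - a) + e * N a b" if e: "e > 0" for e
  proof -
    define P where "P u v \<longleftrightarrow> (a \<le> u \<longrightarrow> v \<le> b \<longrightarrow>
      norm (\<phi> v - \<phi> u) \<le> J v - J u + e * (v - u) + e * N u v)" for u v
    have "P a b"
      using \<open>a \<le> b\<close>
    proof (induction rule: Bolzano)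
      case (trans u v w)
      have "norm (\<phi> w - \<phi> u) \<le> norm (\<phi> v - \<phi> u) + norm (\<phi> w - \<phi> v)"
        using norm_triangle_ineq[of "\<phi> v - \<phi> u" "\<phi> w - \<phi> v"] by simp
      moreover have "e * N u w = e * N u v + e * N v w"
        using N_add[OF trans(3,4)] by (metis distrib_left)
      ultimately show ?case
        using trans unfolding P_def by (auto simp: algebra_simps)
    next
      case (local x)
      show ?case
      proof (cases "x \<in> S")
        case False
        with loc[of x e] local e obtain \<delta> where \<delta>: "\<delta> > 0"
          "\<And>s. s \<in> {a..b} \<Longrightarrow> s \<noteq> x \<Longrightarrow> \<bar>s - x\<bar> < \<delta> \<Longrightarrow>
            norm (\<phi> s - \<phi> x) \<le> sgn (s - x) * (J s - J x) + e * \<bar>s - x\<bar>"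
          unfolding eventually_at dist_real_def by auto
        have "P u v" if "u \<le> x \<and> x \<le> v \<and> v - u < \<delta>" for u v
          unfolding P_def
        proof (intro impI)
          assume ab: "a \<le> u" "v \<le> b"
          have 1: "norm (\<phi> v - \<phi> x) \<le> (J v - J x) + e * (v - x)"
            using \<delta>(2)[of v] that ab by (cases "v = x") auto
          have 2: "norm (\<phi> u - \<phi> x) \<le> (J x - J u) + e * (x - u)"
            using \<delta>(2)[of u] that ab by (cases "u = x") auto
          have "norm (\<phi> v - \<phi> u) \<le> norm (\<phi> v - \<phi> x) + norm (\<phi> u - \<phi> x)"
            using norm_triangle_ineq4[of "\<phi> v - \<phi> x" "\<phi> u - \<phi> x"] by simp
          moreover have "0 \<le> e * N u v" using e N_nonneg by simp
          ultimately show "norm (\<phi> v - \<phi> u) \<le> J v - J u + e * (v - u) + e * N u v"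
            using 1 2 by (simp add: algebra_simps)
        qed
        then show ?thesis using \<delta>(1) by blast
      next
        case True
        have "(\<phi> \<longlongrightarrow> \<phi> x) (at x within {a..b})" "(J \<longlongrightarrow> J x) (at x within {a..b})"
          using \<phi> J local by (auto simp: continuous_on_def)
        then have "\<forall>\<^sub>F s in at x within {a..b}. dist (\<phi> s) (\<phi> x) < e / 4"
          "\<forall>\<^sub>F s in at x within {a..b}. dist (J s) (J x) < e / 4"
          using e by (simp_all only: tendstoD divide_pos_pos zero_less_numeral)
        then have "\<forall>\<^sub>F s in at x within {a..b}. dist (\<phi> s) (\<phi> x) < e / 4 \<and> dist (J s) (J x) < e / 4"
          by (rule eventually_conj)
        then obtain \<delta> where \<delta>: "\<delta> > 0"
          "\<And>s. s \<in> {a..b} \<Longrightarrow> s \<noteq> x \<Longrightarrow> \<bar>s - x\<bar> < \<delta> \<Longrightarrow>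
            norm (\<phi> s - \<phi> x) < e / 4 \<and> \<bar>J s - J x\<bar> < e / 4"
          unfolding eventually_at dist_real_def dist_norm[of "\<phi> _"] by auto
        have \<delta>': "norm (\<phi> s - \<phi> x) \<le> e / 4 \<and> \<bar>J s - J x\<bar> \<le> e / 4"
          if "s \<in> {a..b}" "\<bar>s - x\<bar> < \<delta>" for s
          using \<delta>(2)[of s] that e by (cases "s = x") auto
        have "P u v" if uv: "u \<le> x \<and> x \<le> v \<and> v - u < \<delta>" for u v
          unfolding P_def
        proof (intro impI)
          assume ab: "a \<le> u" "v \<le> b"
          show "norm (\<phi> v - \<phi> u) \<le> J v - J u + e * (v - u) + e * N u v"
          proof (cases "u = v")
            case True
            then show ?thesis using e N_nonneg by simp
          next
            case False
            have "S \<inter> {u..<v} \<noteq> {} \<or> S \<inter> {u<..v} \<noteq> {}"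
              using uv False True by (cases "x = v") auto
            then have "1 \<le> card (S \<inter> {u..<v}) + card (S \<inter> {u<..v})"
              using \<open>finite S\<close> by (metis One_nat_def Suc_leI add_gr_0 card_gt_0_iff finite_Int)
            then have "1 \<le> N u v" unfolding N_def by linarith
            then have "e \<le> e * N u v" using e by simp
            moreover have "norm (\<phi> v - \<phi> u) \<le> norm (\<phi> v - \<phi> x) + norm (\<phi> u - \<phi> x)"
              using norm_triangle_ineq4[of "\<phi> v - \<phi> x" "\<phi> u - \<phi> x"] by simp
            moreover have "0 \<le> e * (v - u)" using e uv by simp
            moreover have "u \<in> {a..b}" "\<bar>u - x\<bar> < \<delta>" "v \<in> {a..b}" "\<bar>v - x\<bar> < \<delta>"
              using uv ab by auto
            note \<delta>'[OF this(1,2)] \<delta>'[OF this(3,4)]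
            ultimately show ?thesis by linarith
          qed
        qed
        then show ?thesis using \<delta>(1) by blast
      qed
    qed
    then show ?thesis by (simp add: P_def)
  qed
  show ?thesis
  proof (rule field_le_epsilon)
    fix e :: real assume e: "e > 0"
    define K where "K = b - a + N a b + 1"
    have K: "K > 0" using \<open>a \<le> b\<close> N_nonneg[of a b] by (simp add: K_def)
    have "norm (\<phi> b - \<phi> a) \<le> J b - J a + (e / K) * (b - a) + (e / K) * N a b"
      using bound[of "e / K"] e K by simp
    also have "\<dots> = J b - J a + (e / K) * (K - 1)" by (simp add: K_def distrib_left)
    also have "(e / K) * (K - 1) \<le> e" using e K by (simp add: field_simps)
    finally show "norm (\<phi> b - \<phi> a) \<le> J b - J a + e" by simp
  qed
qed

section \<open>The logarithm does not lengthen curves\<close>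

definition sqchord :: "'d::finite gpoint \<Rightarrow> 'd gpoint \<Rightarrow> real" where
  "sqchord p q = (norm (fst q - fst p))\<^sup>2 + chord (snd p) (snd q) / 2"

text \<open>
  The global chart by the matrix logarithm, centered at the matrix that the congruence with \<open>H\<close> maps to
  the identity. The factor \<open>1 / sqrt 2\<close> turns the Euclidean norm of the product type into the
  norm of the Riemannian metric at the center.
\<close>

definition log_chart :: "real^'d^'d \<Rightarrow> 'd::finite gpoint \<Rightarrow> 'd gpoint" where
  "log_chart H p = (fst p, (1 / sqrt 2) *\<^sub>R matlog (H ** snd p ** transpose H))"

lemma norm_Pair_power2: "(norm (x, y))\<^sup>2 = (norm x)\<^sup>2 + (norm y)\<^sup>2"
  by (simp add: norm_Pair)

lemma norm_log_chart_diff: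
  "(norm (log_chart H p - log_chart H q))\<^sup>2 = (norm (fst p - fst q))\<^sup>2
    + (norm (matlog (H ** snd p ** transpose H) - matlog (H ** snd q ** transpose H)))\<^sup>2 / 2"
  by (simp add: log_chart_def norm_Pair_power2 power_divide flip: scaleR_diff_right)

text \<open>
  All charts are controlled by the same quantity, because the chord is invariant under congruence.
\<close>

lemma log_chart_le_sqchord:
  assumes "p \<in> gauss_manifold" "q \<in> gauss_manifold" "invertible H"
  shows "(norm (log_chart H p - log_chart H q))\<^sup>2 \<le> sqchord p q"
proof -
  have SPD: "snd p \<in> SPD" "snd q \<in> SPD" using assms by (auto simp: gauss_manifold_def)
  then have "(norm (matlog (H ** snd p ** transpose H) - matlog (H ** snd q ** transpose H)))\<^sup>2
      \<le> chord (snd p) (snd q)"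
    using norm_matlog_diff_le_chord[OF SPD_congruence SPD_congruence] chord_congruence assms(3) by metis
  then show ?thesis
    by (simp add: norm_log_chart_diff sqchord_def norm_minus_commute)
qed

lemma tendsto_sqchord_0:
  assumes f: "(f \<longlongrightarrow> p) F" and p: "p \<in> gauss_manifold"
  shows "((\<lambda>x. sqchord p (f x)) \<longlongrightarrow> 0) F"
proof -
  have "det (snd p) \<noteq> 0" using SPD_det_pos[of "snd p"] p by (auto simp: gauss_manifold_def)
  then have "((\<lambda>x. sqchord p (f x)) \<longlongrightarrow> sqchord p p) F"
    unfolding sqchord_def chord_def
    by (intro tendsto_intros tendsto_trace tendsto_matrix_mult tendsto_matrix_inv f) auto
  then show ?thesis by (simp add: sqchord_def)
qed

lemma sqchord_quotient:
  fixes s t :: real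
  shows "sqchord p q / (s - t)\<^sup>2 = (norm (fst ((q - p) /\<^sub>R (s - t))))\<^sup>2
     + trace (matrix_inv (snd p) ** snd ((q - p) /\<^sub>R (s - t)) ** matrix_inv (snd q)
          ** snd ((q - p) /\<^sub>R (s - t))) / 2"
proof -
  have trace_scaleR: "trace (c *\<^sub>R X) = c * trace X" for c and X :: "real^'a^'a"
    by (simp add: trace_def sum_distrib_left)
  have "(norm (fst (c *\<^sub>R (q - p))))\<^sup>2 + trace (matrix_inv (snd p) ** snd (c *\<^sub>R (q - p))
      ** matrix_inv (snd q) ** snd (c *\<^sub>R (q - p))) / 2 = c\<^sup>2 * sqchord p q" for c
    unfolding sqchord_def chord_def fst_scaleR snd_scaleR fst_diff snd_diff
    by (simp add: matrix_mult_scaleR_left matrix_mult_scaleR_right trace_scaleR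
        power_mult_distrib power2_eq_square distrib_left)
  from this[of "inverse (s - t)"] show ?thesis
    by (simp only: divide_inverse power_inverse mult.commute)
qed

lemma sqchord_tendsto_gmetric:
  assumes \<gamma>: "(\<gamma> has_vector_derivative v) (at t within T)" and p: "\<gamma> t \<in> gauss_manifold"
  shows "((\<lambda>s. sqchord (\<gamma> t) (\<gamma> s) / (s - t)\<^sup>2) \<longlongrightarrow> gmetric (\<gamma> t) v v) (at t within T)"
proof -
  have k: "((\<lambda>s. (\<gamma> s - \<gamma> t) /\<^sub>R (s - t)) \<longlongrightarrow> v) (at t within T)"
  proof -
    have "((\<lambda>s. norm ((\<gamma> s - \<gamma> t) /\<^sub>R (s - t) - v)) \<longlongrightarrow> 0) (at t within T)"
    proof (rule Lim_transform_eventually)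
      show "((\<lambda>s. norm (\<gamma> s - \<gamma> t - (s - t) *\<^sub>R v) / norm (s - t)) \<longlongrightarrow> 0) (at t within T)"
        using \<gamma> unfolding has_vector_derivative_def has_derivative_iff_norm by auto
      show "\<forall>\<^sub>F s in at t within T. norm (\<gamma> s - \<gamma> t - (s - t) *\<^sub>R v) / norm (s - t)
          = norm ((\<gamma> s - \<gamma> t) /\<^sub>R (s - t) - v)"
        unfolding eventually_at_filter
      proof (intro always_eventually allI impI)
        fix s assume "s \<noteq> t"
        then have "(\<gamma> s - \<gamma> t) /\<^sub>R (s - t) - v = (\<gamma> s - \<gamma> t - (s - t) *\<^sub>R v) /\<^sub>R (s - t)"
          by (simp add: scaleR_diff_right)
        then show "norm (\<gamma> s - \<gamma> t - (s - t) *\<^sub>R v) / norm (s - t)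
          = norm ((\<gamma> s - \<gamma> t) /\<^sub>R (s - t) - v)"
          by (simp add: divide_inverse mult.commute)
      qed
    qed
    then show ?thesis
      unfolding tendsto_norm_zero_iff by (rule LIM_zero_cancel)
  qed
  have "continuous (at t within T) \<gamma>"
    using \<gamma> has_vector_derivative_continuous by blast
  then have "((\<lambda>s. \<gamma> s) \<longlongrightarrow> \<gamma> t) (at t within T)"
    by (simp add: continuous_within)
  moreover have "det (snd (\<gamma> t)) \<noteq> 0"
    using SPD_det_pos[of "snd (\<gamma> t)"] p by (auto simp: gauss_manifold_def)
  ultimately have "((\<lambda>s. sqchord (\<gamma> t) (\<gamma> s) / (s - t)\<^sup>2) \<longlongrightarrow> (norm (fst v))\<^sup>2
      + trace (matrix_inv (snd (\<gamma> t)) ** snd v ** matrix_inv (snd (\<gamma> t)) ** snd v) / 2) (at t within T)"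
    unfolding sqchord_quotient
    by (intro tendsto_intros tendsto_trace tendsto_matrix_mult tendsto_matrix_inv k) auto
  then show ?thesis by (simp add: gmetric_def dot_square_norm)
qed

text \<open>
  Along a curve the difference quotients of the chart are bounded by those of \<open>sqchord\<close>, which tend to
  the speed. The indefinite integral of the speed has the speed as its derivative off the break points,
  so that the local bound integrates to the length.
\<close>

lemma log_chart_diff_le_length:
  assumes \<gamma>: "\<gamma> \<in> gcurves p q" and H: "invertible H"
  shows "norm (log_chart H p - log_chart H q) \<le> integral {0..1} (gspeed \<gamma>)"
proof -
  obtain S0 where S0: "finite S0" "\<gamma> C1_differentiable_on ({0..1} - S0)"
    and cont: "continuous_on {0..1} \<gamma>"
    using \<gamma> by (auto simp: gcurves_def valid_path_def piecewise_C1_differentiable_on_def)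
  have mfd: "\<gamma> t \<in> gauss_manifold" if "t \<in> {0..1}" for t
    using \<gamma> that by (auto simp: gcurves_def path_image_def)
  have int: "gspeed \<gamma> integrable_on {0..1}" and ends: "\<gamma> 0 = p" "\<gamma> 1 = q"
    using \<gamma> by (auto simp: gcurves_def pathstart_def pathfinish_def)
  define \<phi> where "\<phi> = (\<lambda>t. log_chart H (\<gamma> t))"
  define J where "J = (\<lambda>t. integral {0..t} (gspeed \<gamma>))"
  define w where "w = (\<lambda>t. vector_derivative \<gamma> (at t))"
  have der: "(\<gamma> has_vector_derivative w t) (at t)" if "t \<in> {0..1} - S0" for t
    using S0(2) that vector_derivative_works unfolding C1_differentiable_on_eq w_def by blast
  have w_cont: "continuous_on ({0..1} - S0) w"
    using S0(2) unfolding C1_differentiable_on_eq w_def by blast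
  have step: "norm (\<phi> s - \<phi> t) \<le> sqrt (sqchord (\<gamma> t) (\<gamma> s))" if "s \<in> {0..1}" "t \<in> {0..1}" for s t
    using log_chart_le_sqchord[OF mfd[OF that(2)] mfd[OF that(1)] H]
    by (simp add: \<phi>_def real_le_rsqrt norm_minus_commute)
  have \<phi>_cont: "continuous_on {0..1} \<phi>"
    unfolding continuous_on_def
  proof
    fix t :: real assume t: "t \<in> {0..1}"
    have "(\<gamma> \<longlongrightarrow> \<gamma> t) (at t within {0..1})" using cont t by (simp add: continuous_on_def)
    from tendsto_real_sqrt[OF tendsto_sqchord_0[OF this mfd[OF t]]]
    have "((\<lambda>s. sqrt (sqchord (\<gamma> t) (\<gamma> s))) \<longlongrightarrow> 0) (at t within {0..1})" by simp
    then have "((\<lambda>s. \<phi> s - \<phi> t) \<longlongrightarrow> 0) (at t within {0..1})"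
      by (rule Lim_null_comparison[rotated]) (use step t in \<open>auto simp: eventually_at_filter\<close>)
    then show "(\<phi> \<longlongrightarrow> \<phi> t) (at t within {0..1})" by (rule LIM_zero_cancel)
  qed
  have J_cont: "continuous_on {0..1} J"
    unfolding J_def by (rule indefinite_integral_continuous_1[OF int])
  have "norm (\<phi> 1 - \<phi> 0) \<le> J 1 - J 0"
  proof (rule norm_diff_le_of_local_bound[OF _ \<phi>_cont J_cont S0(1)])
    fix t e :: real assume t: "t \<in> {0..1} - S0" and e: "e > 0"
    have at_eq: "at t within ({0..1} - S0) = at t within {0..1}"
    proof (rule at_within_nhd)
      show "open (- S0)" using S0(1) by (simp add: finite_imp_closed open_Compl)
    qed (use t in auto)
    have \<gamma>_lim: "(\<gamma> \<longlongrightarrow> \<gamma> t) (at t within {0..1})"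
      using cont t by (simp add: continuous_on_def)
    have "det (snd (\<gamma> t)) \<noteq> 0"
      using SPD_det_pos[of "snd (\<gamma> t)"] mfd[of t] t by (auto simp: gauss_manifold_def)
    moreover have "(w \<longlongrightarrow> w t) (at t within {0..1})"
      unfolding at_eq[symmetric] using w_cont t by (simp add: continuous_on_def)
    ultimately have "(gspeed \<gamma> \<longlongrightarrow> gspeed \<gamma> t) (at t within {0..1})"
      unfolding gspeed_def[abs_def] gmetric_def w_def
      by (intro tendsto_intros tendsto_trace tendsto_matrix_mult tendsto_matrix_inv \<gamma>_lim) auto
    then have "continuous (at t within ({0..1} - S0)) (gspeed \<gamma>)"
      using at_eq by (simp add: continuous_within)
    from integral_has_vector_derivative_continuous_at[OF int t S0(1) this]
    have "(J has_vector_derivative gspeed \<gamma> t) (at t within {0..1})"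
      unfolding J_def at_eq .
    then have "\<forall>\<^sub>F s in at t within {0..1}. norm (J s - J t - (s - t) *\<^sub>R gspeed \<gamma> t) / norm (s - t) < e / 2"
      unfolding has_vector_derivative_def has_derivative_iff_norm
      using e order_tendstoD(2)[of "\<lambda>s. norm (J s - J t - (s - t) *\<^sub>R gspeed \<gamma> t) / norm (s - t)" 0 _ "e/2"] by auto
    moreover have "((\<lambda>s. sqrt (sqchord (\<gamma> t) (\<gamma> s) / (s - t)\<^sup>2)) \<longlongrightarrow> gspeed \<gamma> t) (at t within {0..1})"
    proof -
      have "(\<gamma> has_vector_derivative vector_derivative \<gamma> (at t)) (at t within {0..1})"
        using der[OF t] unfolding w_def by (rule has_vector_derivative_at_within)
      moreover have "\<gamma> t \<in> gauss_manifold" using mfd t by simp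
      ultimately show ?thesis
        unfolding gspeed_def by (intro tendsto_real_sqrt sqchord_tendsto_gmetric)
    qed
    then have "\<forall>\<^sub>F s in at t within {0..1}. sqrt (sqchord (\<gamma> t) (\<gamma> s) / (s - t)\<^sup>2) < gspeed \<gamma> t + e / 2"
      using e by (intro order_tendstoD(2)) auto
    moreover have "\<forall>\<^sub>F s in at t within {0..1}. s \<in> {0..1} \<and> s \<noteq> t"
      by (simp add: eventually_at_filter)
    ultimately show "\<forall>\<^sub>F s in at t within {0..1}.
        norm (\<phi> s - \<phi> t) \<le> sgn (s - t) * (J s - J t) + e * \<bar>s - t\<bar>"
    proof eventually_elim
      case (elim s)
      have pos: "\<bar>s - t\<bar> > 0" using elim by simp
      have "norm (\<phi> s - \<phi> t) \<le> sqrt (sqchord (\<gamma> t) (\<gamma> s))" using step elim t by simp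
      also have "\<dots> = \<bar>s - t\<bar> * sqrt (sqchord (\<gamma> t) (\<gamma> s) / (s - t)\<^sup>2)"
        using pos by (simp add: real_sqrt_divide)
      also have "\<dots> \<le> \<bar>s - t\<bar> * (gspeed \<gamma> t + e / 2)"
        using elim by (intro mult_left_mono) auto
      finally have 1: "norm (\<phi> s - \<phi> t) \<le> \<bar>s - t\<bar> * gspeed \<gamma> t + e / 2 * \<bar>s - t\<bar>"
        by (simp add: algebra_simps)
      have 2: "\<bar>J s - J t - (s - t) * gspeed \<gamma> t\<bar> \<le> e / 2 * \<bar>s - t\<bar>"
        using elim pos by (simp add: divide_less_eq less_imp_le)
      have 3: "\<bar>s - t\<bar> * gspeed \<gamma> t = sgn (s - t) * ((s - t) * gspeed \<gamma> t)"
        by (simp add: abs_sgn mult_ac)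
      have "sgn (s - t) * ((s - t) * gspeed \<gamma> t - (J s - J t)) \<le> \<bar>J s - J t - (s - t) * gspeed \<gamma> t\<bar>"
        using pos by (auto simp: sgn_if)
      then have 4: "sgn (s - t) * ((s - t) * gspeed \<gamma> t) - sgn (s - t) * (J s - J t) \<le> e / 2 * \<bar>s - t\<bar>"
        using 2 unfolding right_diff_distrib by linarith
      have "e * \<bar>s - t\<bar> = e / 2 * \<bar>s - t\<bar> + e / 2 * \<bar>s - t\<bar>" by simp
      then show ?case using 1[unfolded 3] 4 by argo
    qed
  qed simp
  then show ?thesis
    by (simp add: \<phi>_def J_def ends norm_minus_commute)
qed

section \<open>Simultaneous diagonalization and geodesics\<close>

lemma congruence_diag_sum:
  fixes G :: "real^'n^'n"
  shows "G ** diag_mat x ** transpose G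
    = (\<Sum>i\<in>UNIV. x i *\<^sub>R (G ** diag_mat (\<lambda>j. if j = i then 1 else 0) ** transpose G))"
proof -
  have comp: "(G ** diag_mat x ** transpose G) $ k $ l = (\<Sum>i\<in>UNIV. G $ k $ i * x i * G $ l $ i)" for x k l
    using conj_diag_component[of G x k l] by (simp add: conj_diag_def)
  show ?thesis
    by (simp add: vec_eq_iff comp sum_component if_distrib if_distribR mult_ac cong: if_cong)
qed

lemma has_vector_derivative_congruence_diag:
  fixes G :: "real^'n^'n"
  assumes "\<And>i. ((\<lambda>t. x t i) has_real_derivative x' i) (at t)"
  shows "((\<lambda>t. G ** diag_mat (x t) ** transpose G) has_vector_derivative
    G ** diag_mat x' ** transpose G) (at t)"
  unfolding congruence_diag_sum[of G "x _"] congruence_diag_sum[of G x']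
proof (rule has_vector_derivative_sum)
  fix i
  show "((\<lambda>t. x t i *\<^sub>R (G ** diag_mat (\<lambda>j. if j = i then 1 else 0) ** transpose G))
    has_vector_derivative x' i *\<^sub>R (G ** diag_mat (\<lambda>j. if j = i then 1 else 0) ** transpose G)) (at t)"
    using has_vector_derivative_scaleR[OF assms has_vector_derivative_const] by simp
qed

lemma continuous_on_congruence_diag:
  fixes G :: "real^'n^'n"
  assumes "\<And>i. continuous_on T (\<lambda>t. x t i)"
  shows "continuous_on T (\<lambda>t. G ** diag_mat (x t) ** transpose G)"
  unfolding congruence_diag_sum[of G "x _"] by (intro continuous_intros assms)

lemma matrix_inv_diag_mat:
  assumes "\<And>i. x i \<noteq> 0"
  shows "matrix_inv (diag_mat x) = diag_mat (\<lambda>i. 1 / x i)"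
  using assms by (intro matrix_inv_eqI) (simp add: diag_mat_mult diag_mat_1)

text \<open>
  The geodesic between two matrices that the same congruence diagonalizes: interpolate the logarithms
  of the diagonal entries linearly. The invariance under congruence shows that its speed is constant.
\<close>

lemma gcurve_congruence_diag:
  fixes G :: "real^'d::finite^'d"
  assumes G: "invertible G"
  shows "\<exists>\<gamma>\<in>gcurves (m, G ** diag_mat (\<lambda>i. exp (x i)) ** transpose G)
      (n, G ** diag_mat (\<lambda>i. exp (y i)) ** transpose G).
    integral {0..1} (gspeed \<gamma>) = sqrt ((norm (m - n))\<^sup>2 + (\<Sum>i\<in>UNIV. (x i - y i)\<^sup>2) / 2)"
proof -
  define z where "z t i = exp (x i + t * (y i - x i))" for t i
  define \<gamma> where "\<gamma> t = (m + t *\<^sub>R (n - m), G ** diag_mat (z t) ** transpose G)" for t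
  define w where "w t = (n - m, G ** diag_mat (\<lambda>i. (y i - x i) * z t i) ** transpose G)" for t
  define c where "c = sqrt ((norm (m - n))\<^sup>2 + (\<Sum>i\<in>UNIV. (x i - y i)\<^sup>2) / 2)"
  have der: "(\<gamma> has_vector_derivative w t) (at t)" for t
  proof -
    have "((\<lambda>t. m + t *\<^sub>R (n - m)) has_vector_derivative (n - m)) (at t)"
      by (auto intro!: derivative_eq_intros simp: has_vector_derivative_def)
    moreover have "((\<lambda>t. G ** diag_mat (z t) ** transpose G) has_vector_derivative
      G ** diag_mat (\<lambda>i. (y i - x i) * z t i) ** transpose G) (at t)"
      unfolding z_def
      by (intro has_vector_derivative_congruence_diag) (auto intro!: derivative_eq_intros)
    ultimately show ?thesis
      unfolding \<gamma>_def[abs_def] w_def by (rule has_vector_derivative_Pair)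
  qed
  have w_cont: "continuous_on T w" for T
    unfolding w_def z_def
    by (intro continuous_on_Pair continuous_on_congruence_diag continuous_intros)
  have "\<gamma> C1_differentiable_on {0..1}"
    unfolding C1_differentiable_on_def using der w_cont by blast
  then have valid: "valid_path \<gamma>"
    unfolding valid_path_def by (rule C1_differentiable_imp_piecewise)
  have SPD: "diag_mat (z t) \<in> SPD" for t by (intro diag_mat_SPD) (simp add: z_def)
  have speed: "gspeed \<gamma> t = c" for t
  proof -
    have "gmetric (\<gamma> t) (w t) (w t) = (n - m) \<bullet> (n - m)
      + trace (matrix_inv (diag_mat (z t)) ** diag_mat (\<lambda>i. (y i - x i) * z t i)
          ** matrix_inv (diag_mat (z t)) ** diag_mat (\<lambda>i. (y i - x i) * z t i)) / 2"
      unfolding gmetric_def \<gamma>_def w_def fst_conv snd_conv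
      by (simp only: trace_tangent_congruence[OF SPD SPD G])
    also have "\<dots> = (norm (m - n))\<^sup>2 + (\<Sum>i\<in>UNIV. (x i - y i)\<^sup>2) / 2"
    proof -
      have nz: "z t i \<noteq> 0" for i by (simp add: z_def)
      then have "1 / z t i * ((y i - x i) * z t i) * (1 / z t i) * ((y i - x i) * z t i) = (x i - y i)\<^sup>2" for i
        by (simp add: field_simps power2_eq_square)
      then show ?thesis
        by (simp only: matrix_inv_diag_mat[OF nz] diag_mat_mult trace_diag_mat dot_square_norm
          norm_minus_commute)
    qed
    finally show ?thesis
      unfolding gspeed_def vector_derivative_at[OF der] c_def by simp
  qed
  have "\<gamma> \<in> gcurves (m, G ** diag_mat (\<lambda>i. exp (x i)) ** transpose G)
      (n, G ** diag_mat (\<lambda>i. exp (y i)) ** transpose G)"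
    unfolding gcurves_def
  proof (intro CollectI conjI valid)
    show "path_image \<gamma> \<subseteq> gauss_manifold"
      using SPD_congruence[OF SPD G] by (auto simp: path_image_def \<gamma>_def gauss_manifold_def)
    show "pathstart \<gamma> = (m, G ** diag_mat (\<lambda>i. exp (x i)) ** transpose G)"
      "pathfinish \<gamma> = (n, G ** diag_mat (\<lambda>i. exp (y i)) ** transpose G)"
      by (simp_all add: pathstart_def pathfinish_def \<gamma>_def z_def[abs_def])
    show "gspeed \<gamma> integrable_on {0..1}"
      unfolding speed[abs_def] using integrable_const_ivl by blast
  qed
  moreover have "integral {0..1} (gspeed \<gamma>) = c"
    unfolding speed[abs_def] by simp
  ultimately show ?thesis unfolding c_def by blast
qed

text \<open>
  Two positive definite matrices are diagonalized by one congruence. The diagonal factors can moreover be made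
  inverse to each other, which places the midpoint of the geodesic at the image of the identity.
\<close>

lemma SPD_simultaneous_diag:
  fixes A B :: "real^'d^'d"
  assumes A: "A \<in> SPD" and B: "B \<in> SPD"
  obtains G :: "real^'d^'d" and x where "invertible G" "A = G ** diag_mat (\<lambda>i. exp (x i)) ** transpose G"
    "B = G ** diag_mat (\<lambda>i. exp (- x i)) ** transpose G"
proof -
  obtain U a where U: "orthogonal_matrix U" "\<And>i. 0 < a i" and A_eq: "A = conj_diag U a"
    using obtain_SPD_conj_diag[OF A] by blast
  define R where "R = U ** diag_mat (\<lambda>i. sqrt (a i))"
  have RR: "R ** transpose R = A"
  proof -
    have "R ** transpose R = U ** (diag_mat (\<lambda>i. sqrt (a i)) ** diag_mat (\<lambda>i. sqrt (a i))) ** transpose U"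
      by (simp add: R_def matrix_transpose_mul matrix_mul_assoc)
    also have "\<dots> = A"
      using U(2) by (simp add: diag_mat_mult A_eq conj_diag_def less_imp_le)
    finally show ?thesis .
  qed
  have "invertible (diag_mat (\<lambda>i. sqrt (a i)))"
    using U(2) less_imp_neq[OF U(2)] by (auto simp: invertible_right_inverse diag_mat_mult less_imp_neq[symmetric] diag_mat_1
        intro!: exI[of _ "diag_mat (\<lambda>i. 1 / sqrt (a i))"])
  then have invR: "invertible R"
    unfolding R_def by (rule invertible_mult[OF orthogonal_matrix_invertible[OF U(1)]])
  then obtain R' where R': "R ** R' = mat 1" "R' ** R = mat 1" by (auto simp: invertible_def)
  then have invR': "invertible R'" by (auto simp: invertible_def)
  obtain V b where V: "orthogonal_matrix V" "\<And>i. 0 < b i" and B_eq: "R' ** B ** transpose R' = conj_diag V b"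
    using obtain_SPD_conj_diag[OF SPD_congruence[OF B invR']] by blast
  have B2: "B = R ** conj_diag V b ** transpose R"
  proof -
    have "R ** conj_diag V b ** transpose R = (R ** R') ** B ** transpose (R ** R')"
      by (simp add: B_eq[symmetric] matrix_transpose_mul matrix_mul_assoc)
    then show ?thesis using R' by (simp add: transpose_mat)
  qed
  \<comment> \<open>So far \<open>R ** V\<close> carries the identity to \<open>A\<close> and \<open>diag_mat b\<close> to \<open>B\<close>. The fourth root balances them
    to \<open>b\<^sup>-\<^sup>1\<^sup>/\<^sup>2\<close> and \<open>b\<^sup>1\<^sup>/\<^sup>2\<close>.\<close>
  define D where "D = diag_mat (\<lambda>i. exp (ln (b i) / 4))"
  define G where "G = R ** V ** D"
  have conj: "G ** diag_mat h ** transpose G = R ** conj_diag V (\<lambda>i. exp (ln (b i) / 2) * h i) ** transpose R" for h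
  proof -
    have "G ** diag_mat h ** transpose G = R ** (V ** (D ** diag_mat h ** D) ** transpose V) ** transpose R"
      by (simp add: G_def matrix_transpose_mul matrix_mul_assoc D_def)
    also have "D ** diag_mat h ** D = diag_mat (\<lambda>i. exp (ln (b i) / 2) * h i)"
    proof -
      have "(\<lambda>i. exp (ln (b i) / 4) * h i * exp (ln (b i) / 4)) = (\<lambda>i. exp (ln (b i) / 2) * h i)"
      proof
        fix i
        have "exp (ln (b i) / 2) = exp (ln (b i) / 4) * exp (ln (b i) / 4)"
          by (simp flip: exp_add)
        then show "exp (ln (b i) / 4) * h i * exp (ln (b i) / 4) = exp (ln (b i) / 2) * h i"
          by (simp only: mult_ac)
      qed
      then show ?thesis by (simp only: D_def diag_mat_mult)
    qed
    finally show ?thesis by (simp add: conj_diag_def)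
  qed
  have "invertible D"
    unfolding D_def invertible_right_inverse
    by (rule exI[of _ "diag_mat (\<lambda>i. exp (- (ln (b i) / 4)))"])
      (simp add: diag_mat_mult diag_mat_1 exp_minus)
  then have "invertible G"
    unfolding G_def
    by (rule invertible_mult[OF invertible_mult[OF invR orthogonal_matrix_invertible[OF V(1)]]])
  moreover have "A = G ** diag_mat (\<lambda>i. exp (- (ln (b i) / 2))) ** transpose G"
    unfolding conj by (simp add: conj_diag_one[OF V(1)] RR flip: exp_add)
  moreover have "B = G ** diag_mat (\<lambda>i. exp (- (- (ln (b i) / 2)))) ** transpose G"
    unfolding conj B2 using V(2) by (simp flip: exp_add)
  ultimately show ?thesis by (rule that)
qed

section \<open>The Riemannian distance in logarithmic charts\<close>

lemma gcurves_nonempty: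
  fixes p q :: "'d::finite gpoint"
  assumes "p \<in> gauss_manifold" "q \<in> gauss_manifold"
  shows "gcurves p q \<noteq> {}"
proof -
  have "snd p \<in> SPD" "snd q \<in> SPD" using assms by (auto simp: gauss_manifold_def)
  then obtain G :: "real^'d^'d" and x where G: "invertible G" "snd p = G ** diag_mat (\<lambda>i. exp (x i)) ** transpose G"
    "snd q = G ** diag_mat (\<lambda>i. exp (- x i)) ** transpose G"
    by (rule SPD_simultaneous_diag)
  have "gcurves (fst p, snd p) (fst q, snd q) \<noteq> {}"
    using gcurve_congruence_diag[OF G(1), of "fst p" x "fst q" "\<lambda>i. - x i"] unfolding G by blast
  then show ?thesis by simp
qed

lemma log_chart_le_gdist:
  assumes "p \<in> gauss_manifold" "q \<in> gauss_manifold" "invertible H"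
  shows "norm (log_chart H p - log_chart H q) \<le> gdist p q"
  unfolding gdist_def
  by (rule cINF_greatest[OF gcurves_nonempty[OF assms(1,2)] log_chart_diff_le_length[OF _ assms(3)]])

lemma gdist_congruence_diag_le:
  fixes G :: "real^'d::finite^'d"
  assumes G: "invertible G"
  shows "gdist (m, G ** diag_mat (\<lambda>i. exp (x i)) ** transpose G) (n, G ** diag_mat (\<lambda>i. exp (y i)) ** transpose G)
    \<le> sqrt ((norm (m - n))\<^sup>2 + (\<Sum>i\<in>UNIV. (x i - y i)\<^sup>2) / 2)"
proof -
  let ?p = "(m, G ** diag_mat (\<lambda>i. exp (x i)) ** transpose G)"
  let ?q = "(n, G ** diag_mat (\<lambda>i. exp (y i)) ** transpose G)"
  obtain \<gamma> where \<gamma>: "\<gamma> \<in> gcurves ?p ?q"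
    "integral {0..1} (gspeed \<gamma>) = sqrt ((norm (m - n))\<^sup>2 + (\<Sum>i\<in>UNIV. (x i - y i)\<^sup>2) / 2)"
    using gcurve_congruence_diag[OF G] by blast
  have "bdd_below ((\<lambda>\<gamma>. integral {0..1} (gspeed \<gamma>)) ` gcurves ?p ?q)"
  proof (rule bdd_belowI2)
    fix \<delta> assume "\<delta> \<in> gcurves ?p ?q"
    then show "0 \<le> integral {0..1} (gspeed \<delta>)"
      using log_chart_diff_le_length[OF _ G] norm_ge_zero order_trans by blast
  qed
  from cINF_lower[OF this \<gamma>(1)] show ?thesis
    using \<gamma>(2) by (simp add: gdist_def)
qed

lemma norm_log_chart_diff_diag:
  assumes "orthogonal_matrix U" "H ** G = U"
  shows "(norm (log_chart H (m, G ** diag_mat (\<lambda>i. exp (x i)) ** transpose G)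
      - log_chart H (n, G ** diag_mat (\<lambda>i. exp (y i)) ** transpose G)))\<^sup>2
    = (norm (m - n))\<^sup>2 + (\<Sum>i\<in>UNIV. (x i - y i)\<^sup>2) / 2"
proof -
  have H: "H ** (G ** diag_mat h ** transpose G) ** transpose H = conj_diag U h" for h
    by (simp add: conj_diag_def assms(2)[symmetric] matrix_transpose_mul matrix_mul_assoc)
  have "conj_diag U x - conj_diag U y = conj_diag U (\<lambda>i. x i - y i)"
    by (simp add: vec_eq_iff conj_diag_component algebra_simps sum_subtractf)
  then show ?thesis
    unfolding norm_log_chart_diff
    by (simp add: H matlog_conj_diag[OF assms(1)] norm_conj_diag[OF assms(1)])
qed

lemma gdist_congruence_diag_le_log_chart:
  assumes "invertible G" "orthogonal_matrix U" "H ** G = U"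
  shows "gdist (m, G ** diag_mat (\<lambda>i. exp (x i)) ** transpose G) (n, G ** diag_mat (\<lambda>i. exp (y i)) ** transpose G)
    \<le> norm (log_chart H (m, G ** diag_mat (\<lambda>i. exp (x i)) ** transpose G)
      - log_chart H (n, G ** diag_mat (\<lambda>i. exp (y i)) ** transpose G))"
  using gdist_congruence_diag_le[OF assms(1), of m x n y]
  unfolding norm_log_chart_diff_diag[OF assms(2,3), symmetric] real_sqrt_abs abs_norm_cancel .

text \<open>
  Together with \<open>log_chart_le_gdist\<close> this says that the distance is the maximum, over all charts, of the
  Euclidean distance of the images. The metric axioms therefore follow from those of the Euclidean distance.
\<close>

lemma gdist_eq_log_chart:
  fixes p q :: "'d::finite gpoint"
  assumes p: "p \<in> gauss_manifold" and q: "q \<in> gauss_manifold"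
  obtains H where "invertible H" "gdist p q = norm (log_chart H p - log_chart H q)"
proof -
  have "snd p \<in> SPD" "snd q \<in> SPD" using assms by (auto simp: gauss_manifold_def)
  then obtain G :: "real^'d^'d" and x where G: "invertible G" "snd p = G ** diag_mat (\<lambda>i. exp (x i)) ** transpose G"
    "snd q = G ** diag_mat (\<lambda>i. exp (- x i)) ** transpose G"
    by (rule SPD_simultaneous_diag)
  then have pq: "p = (fst p, G ** diag_mat (\<lambda>i. exp (x i)) ** transpose G)"
    "q = (fst q, G ** diag_mat (\<lambda>i. exp (- x i)) ** transpose G)" by (simp_all add: prod_eq_iff G)
  obtain H where H: "G ** H = mat 1" "H ** G = mat 1" using G(1) by (auto simp: invertible_def)
  then have "invertible H" by (auto simp: invertible_def)
  moreover have "gdist p q \<le> norm (log_chart H p - log_chart H q)"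
    using gdist_congruence_diag_le_log_chart[OF G(1) orthogonal_matrix_id H(2), of "fst p" x "fst q" "\<lambda>i. - x i"]
    unfolding pq(1)[symmetric] pq(2)[symmetric] .
  ultimately show ?thesis
    using that log_chart_le_gdist[OF p q] by (metis antisym)
qed

lemma log_chart_inj:
  assumes "p \<in> gauss_manifold" "q \<in> gauss_manifold" "invertible H" "log_chart H p = log_chart H q"
  shows "p = q"
proof -
  have SPD: "snd p \<in> SPD" "snd q \<in> SPD" using assms by (auto simp: gauss_manifold_def)
  have "matlog (H ** snd p ** transpose H) = matlog (H ** snd q ** transpose H)"
    using assms(4) by (simp add: log_chart_def)
  then have eq: "H ** snd p ** transpose H = H ** snd q ** transpose H"
    using SPD_congruence[OF _ assms(3)] SPD matexp_matlog by metis
  obtain K where K: "K ** H = mat 1" using assms(3) by (auto simp: invertible_def)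
  have cancel: "K ** (H ** X ** transpose H) ** transpose K = X" for X
  proof -
    have "K ** (H ** X ** transpose H) ** transpose K = (K ** H) ** X ** transpose (K ** H)"
      by (simp add: matrix_transpose_mul matrix_mul_assoc)
    then show ?thesis by (simp add: K transpose_mat)
  qed
  have "snd p = snd q"
    using arg_cong[OF eq, of "\<lambda>X. K ** X ** transpose K"] unfolding cancel .
  then show ?thesis using assms(4) by (simp add: log_chart_def prod_eq_iff)
qed

text \<open>
  The distance made total with the value \<open>0\<close>, since \<^locale>\<open>Metric_space\<close> asks for nonnegativity and symmetry on
  the whole type while \<^const>\<open>gdist\<close> is an infimum over the empty set off the manifold.
\<close>

definition gauss_dist :: "'d::finite gpoint \<Rightarrow> 'd gpoint \<Rightarrow> real" where
  "gauss_dist p q = (if p \<in> gauss_manifold \<and> q \<in> gauss_manifold then gdist p q else 0)"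

lemma Metric_space_gauss_dist: "Metric_space (gauss_manifold :: 'd::finite gpoint set) gauss_dist"
proof
  fix p q r :: "'d gpoint"
  have nn: "0 \<le> gdist p q" if "p \<in> gauss_manifold" "q \<in> gauss_manifold" for p q :: "'d gpoint"
    using gdist_eq_log_chart[OF that] norm_ge_zero by metis
  then show "0 \<le> gauss_dist p q" by (simp add: gauss_dist_def)
  show "gauss_dist p q = gauss_dist q p"
  proof -
    have le: "gdist p q \<le> gdist q p" if "p \<in> gauss_manifold" "q \<in> gauss_manifold" for p q :: "'d gpoint"
      using gdist_eq_log_chart[OF that] log_chart_le_gdist[OF that(2,1)] norm_minus_commute by metis
    show ?thesis unfolding gauss_dist_def using le[of p q] le[of q p] by auto
  qed
  show "gauss_dist p q = 0 \<longleftrightarrow> p = q" if pq: "p \<in> gauss_manifold" "q \<in> gauss_manifold"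
  proof -
    obtain H where H: "invertible H" "gdist p q = norm (log_chart H p - log_chart H q)"
      using gdist_eq_log_chart[OF pq] by blast
    then show ?thesis using log_chart_inj[OF pq H(1)] pq by (auto simp: gauss_dist_def)
  qed
  show "gauss_dist p r \<le> gauss_dist p q + gauss_dist q r"
    if M: "p \<in> gauss_manifold" "q \<in> gauss_manifold" "r \<in> gauss_manifold"
  proof -
    obtain H where H: "invertible H" "gdist p r = norm (log_chart H p - log_chart H r)"
      using gdist_eq_log_chart[OF M(1,3)] by blast
    have "norm (log_chart H p - log_chart H r)
        \<le> norm (log_chart H p - log_chart H q) + norm (log_chart H q - log_chart H r)"
      using norm_triangle_ineq[of "log_chart H p - log_chart H q" "log_chart H q - log_chart H r"] by simp
    also have "\<dots> \<le> gdist p q + gdist q r"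
      using M H(1) by (intro add_mono log_chart_le_gdist)
    finally show ?thesis using M H(2) by (simp add: gauss_dist_def)
  qed
qed

section \<open>Barycenters in complete metric spaces of nonpositive curvature\<close>

text \<open>
  The CN inequality of Bruhat and Tits: every pair of points has a midpoint for which the parallelogram law
  of Euclidean geometry holds as an inequality. For complete spaces it characterizes nonpositive curvature
  in the sense of Alexandrov.
\<close>

locale cn_space = Metric_space +
  assumes cn_inequality: "x \<in> M \<Longrightarrow> y \<in> M \<Longrightarrow>
      \<exists>m\<in>M. \<forall>z\<in>M. (d z m)\<^sup>2 \<le> (d z x)\<^sup>2 / 2 + (d z y)\<^sup>2 / 2 - (d x y)\<^sup>2 / 4"
    and complete: "mcomplete"
begin

text \<open>
  Berg and Nikolaev's quasilinearization: in a Euclidean space \<open>quad a b c e\<close> equals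
  \<open>2 * ((b - a) \<bullet> (e - c))\<close>, and \<open>quad_le\<close> below is a Cauchy-Schwarz inequality for it.
\<close>

definition quad :: "'a \<Rightarrow> 'a \<Rightarrow> 'a \<Rightarrow> 'a \<Rightarrow> real" where
  "quad a b c e = (d a e)\<^sup>2 + (d b c)\<^sup>2 - (d a c)\<^sup>2 - (d b e)\<^sup>2"

lemma quad_swap: "quad a b c e = quad c e a b"
  by (simp add: quad_def commute)

lemma quad_split: "quad a b c e = quad a m c e + quad m b c e"
  by (simp add: quad_def)

text \<open>
  The sum of the squared diagonals of a quadrilateral is at most that of its four sides: compare
  both other corners with the midpoint of the diagonal from \<open>a\<close> to \<open>e\<close>.
\<close>

lemma quad_le_sum:
  assumes "a \<in> M" "b \<in> M" "c \<in> M" "e \<in> M"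
  shows "quad a b c e \<le> (d a b)\<^sup>2 + (d c e)\<^sup>2"
proof -
  obtain m where m: "m \<in> M"
    "\<And>z. z \<in> M \<Longrightarrow> (d z m)\<^sup>2 \<le> (d z a)\<^sup>2 / 2 + (d z e)\<^sup>2 / 2 - (d a e)\<^sup>2 / 4"
    using cn_inequality[OF assms(1,4)] by blast
  have "(d b c)\<^sup>2 \<le> (d b m + d c m)\<^sup>2"
    using triangle[of b m c] assms m(1) by (intro power_mono) (auto simp: commute)
  also have "\<dots> \<le> 2 * (d b m)\<^sup>2 + 2 * (d c m)\<^sup>2"
    using sum_squares_bound[of "d b m" "d c m"] by (simp add: power2_sum)
  finally show ?thesis
    using m(2)[OF assms(2)] m(2)[OF assms(3)] commute[of b a]
    unfolding quad_def commute[of b a] commute[of c a] by simp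
qed

text \<open>
  The previous inequality only has a sum of squares on the right. Since \<open>quad\<close> is additive when the segment from \<open>a\<close>
  to \<open>b\<close> is cut at its midpoint, halving that segment \<open>k\<close> times trades the two squares against each other.
\<close>

lemma quad_le_scaled:
  assumes "a \<in> M" "b \<in> M" "c \<in> M" "e \<in> M"
  shows "quad a b c e \<le> (d a b)\<^sup>2 / 2 ^ k + 2 ^ k * (d c e)\<^sup>2"
  using assms(1,2)
proof (induction k arbitrary: a b)
  case 0
  then show ?case using quad_le_sum assms by simp
next
  case (Suc k)
  obtain m where m: "m \<in> M"
    "\<And>z. z \<in> M \<Longrightarrow> (d z m)\<^sup>2 \<le> (d z a)\<^sup>2 / 2 + (d z b)\<^sup>2 / 2 - (d a b)\<^sup>2 / 4"
    using cn_inequality[OF Suc.prems] by blast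
  have half: "(d a m)\<^sup>2 \<le> (d a b)\<^sup>2 / 4" "(d m b)\<^sup>2 \<le> (d a b)\<^sup>2 / 4"
    using m(2)[OF Suc.prems(1)] m(2)[OF Suc.prems(2)] Suc.prems
    by (auto simp: commute[of b a] commute[of b m])
  have "quad a b c e = quad a m c e + quad m b c e" by (rule quad_split)
  also have "\<dots> \<le> ((d a m)\<^sup>2 / 2 ^ k + 2 ^ k * (d c e)\<^sup>2) + ((d m b)\<^sup>2 / 2 ^ k + 2 ^ k * (d c e)\<^sup>2)"
    using Suc.IH Suc.prems m(1) by (intro add_mono) auto
  also have "\<dots> \<le> ((d a b)\<^sup>2 / 4 / 2 ^ k + 2 ^ k * (d c e)\<^sup>2) + ((d a b)\<^sup>2 / 4 / 2 ^ k + 2 ^ k * (d c e)\<^sup>2)"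
    using half by (intro add_mono divide_right_mono) auto
  also have "\<dots> = (d a b)\<^sup>2 / 2 ^ Suc k + 2 ^ Suc k * (d c e)\<^sup>2" by simp
  finally show ?case .
qed

text \<open>
  Choosing the number of halvings so that the two sides become comparable turns the sum of squares
  into a product. The factor \<open>3\<close> instead of Reshetnyak's \<open>2\<close> is the price of only using powers of 2.
\<close>

lemma quad_le:
  assumes "a \<in> M" "b \<in> M" "c \<in> M" "e \<in> M"
  shows "quad a b c e \<le> 3 * d a b * d c e"
proof -
  have main: "quad a b c e \<le> 3 * d a b * d c e"
    if M: "a \<in> M" "b \<in> M" "c \<in> M" "e \<in> M" and le: "d c e \<le> d a b" for a b c e
  proof (cases "d c e = 0")
    case True
    then have "c = e" using M by simp
    then show ?thesis by (simp add: quad_def True)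
  next
    case False
    then have pos: "d c e > 0" by (simp add: less_le)
    \<comment> \<open>\<open>k\<close> will be the exponent with \<open>2 ^ k \<le> x < 2 ^ (k + 1)\<close>.\<close>
    define x where "x = d a b / d c e"
    have x: "1 \<le> x" using le pos by (simp add: x_def)
    obtain n where n: "x < 2 ^ n" using real_arch_pow[of 2 x] by auto
    define l where "l = (LEAST n. x < 2 ^ n)"
    have l: "x < 2 ^ l" unfolding l_def by (rule LeastI[of "\<lambda>n. x < 2 ^ n", OF n])
    have "l \<noteq> 0" using l x by (intro notI) simp
    then obtain k where k: "l = Suc k" using not0_implies_Suc by blast
    have "\<not> x < 2 ^ k"
      using not_less_Least[of k "\<lambda>n. x < 2 ^ n"] k by (simp add: l_def)
    then have lo: "2 ^ k * d c e \<le> d a b" and hi: "d a b \<le> 2 * 2 ^ k * d c e"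
      using l k pos by (auto simp: x_def field_simps)
    have "quad a b c e \<le> (d a b)\<^sup>2 / 2 ^ k + 2 ^ k * (d c e)\<^sup>2"
      by (rule quad_le_scaled[OF M])
    also have "(d a b)\<^sup>2 / 2 ^ k \<le> 2 * d a b * d c e"
      using mult_left_mono[OF hi, of "d a b"] by (simp add: field_simps power2_eq_square)
    also have "2 ^ k * (d c e)\<^sup>2 \<le> d a b * d c e"
      using mult_right_mono[OF lo, of "d c e"] by (simp add: field_simps power2_eq_square)
    finally show ?thesis by simp
  qed
  show ?thesis
  proof (cases "d c e \<le> d a b")
    case True
    with main assms show ?thesis by blast
  next
    case False
    with main[of c e a b] assms show ?thesis
      by (simp add: quad_swap[of a b c e] mult_ac)
  qed
qed

definition square_integrable_map :: "'b measure \<Rightarrow> ('b \<Rightarrow> 'a) \<Rightarrow> bool" where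
  "square_integrable_map P f \<longleftrightarrow> prob_space P \<and> (\<forall>\<omega>\<in>space P. f \<omega> \<in> M) \<and>
     (\<forall>z\<in>M. (\<lambda>\<omega>. d z (f \<omega>)) \<in> borel_measurable P \<and> integrable P (\<lambda>\<omega>. (d z (f \<omega>))\<^sup>2))"

definition spread :: "'b measure \<Rightarrow> ('b \<Rightarrow> 'a) \<Rightarrow> 'a \<Rightarrow> real" where
  "spread P f z = (\<integral>\<omega>. (d z (f \<omega>))\<^sup>2 \<partial>P)"

definition minimizes_spread :: "'b measure \<Rightarrow> ('b \<Rightarrow> 'a) \<Rightarrow> 'a \<Rightarrow> bool" where
  "minimizes_spread P f z \<longleftrightarrow> z \<in> M \<and> (\<forall>y\<in>M. spread P f z \<le> spread P f y)"

lemma spread_midpoint: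
  assumes f: "square_integrable_map P f" and "x \<in> M" "y \<in> M"
  shows "\<exists>m\<in>M. spread P f m \<le> spread P f x / 2 + spread P f y / 2 - (d x y)\<^sup>2 / 4"
proof -
  interpret prob_space P using f by (simp add: square_integrable_map_def)
  obtain m where m: "m \<in> M"
    "\<And>z. z \<in> M \<Longrightarrow> (d z m)\<^sup>2 \<le> (d z x)\<^sup>2 / 2 + (d z y)\<^sup>2 / 2 - (d x y)\<^sup>2 / 4"
    using cn_inequality[OF assms(2,3)] by blast
  have int: "integrable P (\<lambda>\<omega>. (d z (f \<omega>))\<^sup>2)" if "z \<in> M" for z
    using f that by (simp add: square_integrable_map_def)
  have "spread P f m \<le> (\<integral>\<omega>. (d x (f \<omega>))\<^sup>2 / 2 + (d y (f \<omega>))\<^sup>2 / 2 - (d x y)\<^sup>2 / 4 \<partial>P)"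
    unfolding spread_def
  proof (rule integral_mono)
    fix \<omega> assume "\<omega> \<in> space P"
    then have "f \<omega> \<in> M" using f by (simp add: square_integrable_map_def)
    from m(2)[OF this] show "(d m (f \<omega>))\<^sup>2 \<le> (d x (f \<omega>))\<^sup>2 / 2 + (d y (f \<omega>))\<^sup>2 / 2 - (d x y)\<^sup>2 / 4"
      by (simp add: commute[of "f \<omega>"])
  qed (use int m(1) assms in auto)
  also have "\<dots> = spread P f x / 2 + spread P f y / 2 - (d x y)\<^sup>2 / 4"
    using int assms by (simp add: spread_def prob_space)
  finally show ?thesis using m(1) by blast
qed

text \<open>
  Uniform convexity at the minimizer: it cannot be beaten by its midpoint with \<open>y\<close>. This gives uniqueness,
  and the quantitative form is what the Lipschitz estimate rests on.
\<close>

lemma variance_inequality: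
  assumes "square_integrable_map P f" "minimizes_spread P f b" "y \<in> M"
  shows "(d b y)\<^sup>2 \<le> 2 * (spread P f y - spread P f b)"
proof -
  have b: "b \<in> M" using assms(2) by (simp add: minimizes_spread_def)
  obtain m where "m \<in> M" "spread P f m \<le> spread P f b / 2 + spread P f y / 2 - (d b y)\<^sup>2 / 4"
    using spread_midpoint[OF assms(1) b assms(3)] by blast
  moreover have "spread P f b \<le> spread P f m"
    using assms(2) \<open>m \<in> M\<close> by (simp add: minimizes_spread_def)
  ultimately show ?thesis by simp
qed

lemma minimizes_spread_unique:
  assumes "square_integrable_map P f" "minimizes_spread P f a" "minimizes_spread P f b"
  shows "a = b"
proof -
  have ab: "a \<in> M" "b \<in> M" "spread P f a = spread P f b"
    using assms(2,3) by (auto simp: minimizes_spread_def intro: antisym)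
  then have "(d a b)\<^sup>2 \<le> 0"
    using variance_inequality[OF assms(1,2) ab(2)] by simp
  then show ?thesis using ab by simp
qed

lemma integrable_dist_map:
  assumes f: "square_integrable_map P f" and z: "z \<in> M"
  shows "integrable P (\<lambda>\<omega>. d z (f \<omega>))"
proof (rule Bochner_Integration.integrable_bound)
  interpret prob_space P using f by (simp add: square_integrable_map_def)
  show "integrable P (\<lambda>\<omega>. 1 + (d z (f \<omega>))\<^sup>2)"
    using f z by (simp add: square_integrable_map_def)
  have "s \<le> 1 + s\<^sup>2" for s :: real
    using sum_squares_bound[of 1 s] zero_le_power2[of s] unfolding one_power2 by linarith
  then show "AE \<omega> in P. norm (d z (f \<omega>)) \<le> norm (1 + (d z (f \<omega>))\<^sup>2)" by simp
qed (use f z in \<open>simp add: square_integrable_map_def\<close>)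

lemma spread_continuous_bound:
  assumes f: "square_integrable_map P f" and "x \<in> M" "y \<in> M"
  shows "spread P f x \<le> spread P f y + d x y * (2 * (\<integral>\<omega>. d x (f \<omega>) \<partial>P) + d x y)"
proof -
  interpret prob_space P using f by (simp add: square_integrable_map_def)
  have int: "integrable P (\<lambda>\<omega>. (d z (f \<omega>))\<^sup>2)" if "z \<in> M" for z
    using f that by (simp add: square_integrable_map_def)
  have int1: "integrable P (\<lambda>\<omega>. d x (f \<omega>))"
    using f assms(2) by (rule integrable_dist_map)
  have "spread P f x \<le> (\<integral>\<omega>. (d y (f \<omega>))\<^sup>2 + d x y * (2 * d x (f \<omega>) + d x y) \<partial>P)"
    unfolding spread_def
  proof (rule integral_mono)
    fix \<omega> assume "\<omega> \<in> space P"
    then have fM: "f \<omega> \<in> M" using f by (simp add: square_integrable_map_def)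
    have t: "d x (f \<omega>) - d y (f \<omega>) \<le> d x y" "d y (f \<omega>) \<le> d x (f \<omega>) + d x y"
      using triangle[OF assms(2,3) fM] triangle[OF assms(3,2) fM] commute[of y x] by linarith+
    have "(d x (f \<omega>))\<^sup>2 - (d y (f \<omega>))\<^sup>2 = (d x (f \<omega>) - d y (f \<omega>)) * (d x (f \<omega>) + d y (f \<omega>))"
      by (simp add: power2_eq_square algebra_simps)
    also have "\<dots> \<le> d x y * (d x (f \<omega>) + d y (f \<omega>))"
      using t by (intro mult_right_mono) auto
    also have "\<dots> \<le> d x y * (2 * d x (f \<omega>) + d x y)"
      using t by (intro mult_left_mono) auto
    finally show "(d x (f \<omega>))\<^sup>2 \<le> (d y (f \<omega>))\<^sup>2 + d x y * (2 * d x (f \<omega>) + d x y)" by simp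
  qed (use int int1 assms in auto)
  also have "\<dots> = spread P f y + d x y * (2 * (\<integral>\<omega>. d x (f \<omega>) \<partial>P) + d x y)"
    using int int1 assms by (simp add: spread_def prob_space)
  finally show ?thesis .
qed

text \<open>
  By the CN inequality a minimizing sequence is a Cauchy sequence, since the midpoint of two almost minimal points
  would otherwise fall below the infimum.
\<close>

theorem ex_minimizes_spread:
  assumes f: "square_integrable_map P f"
  shows "\<exists>b. minimizes_spread P f b"
proof -
  interpret prob_space P using f by (simp add: square_integrable_map_def)
  obtain \<omega> where "\<omega> \<in> space P" using not_empty by blast
  then have ne: "M \<noteq> {}" using f by (auto simp: square_integrable_map_def)
  define v where "v = (INF z\<in>M. spread P f z)"
  have bdd: "bdd_below (spread P f ` M)"
    by (rule bdd_belowI2[of _ 0]) (simp add: spread_def)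
  have v: "v \<le> spread P f z" if "z \<in> M" for z
    unfolding v_def using bdd that by (rule cINF_lower)
  have "\<exists>z\<in>M. spread P f z < v + 1 / Suc n" for n
    using cINF_less_iff[OF ne bdd, of "v + 1 / Suc n"] by (simp add: v_def)
  then obtain s where s: "s n \<in> M" "spread P f (s n) < v + 1 / Suc n" for n
    by metis
  have dist: "(d (s n) (s k))\<^sup>2 \<le> 2 / Suc n + 2 / Suc k" for n k
  proof -
    obtain m where "m \<in> M"
      "spread P f m \<le> spread P f (s n) / 2 + spread P f (s k) / 2 - (d (s n) (s k))\<^sup>2 / 4"
      using spread_midpoint[OF f s(1) s(1)] by blast
    then show ?thesis using v[of m] s(2)[of n] s(2)[of k] by simp
  qed
  have "MCauchy s"
    unfolding MCauchy_def
  proof (intro conjI allI impI)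
    fix e :: real assume e: "e > 0"
    obtain N where N: "4 / e\<^sup>2 < real N" using reals_Archimedean2 by blast
    have "d (s n) (s k) < e" if "n \<ge> N" "k \<ge> N" for n k
    proof -
      have "0 < N" using N e by (metis less_trans of_nat_0_less_iff zero_less_divide_iff zero_less_numeral zero_less_power)
      have "2 / Suc n + 2 / Suc k \<le> 2 / N + 2 / N"
        using that \<open>0 < N\<close> by (intro add_mono divide_left_mono) auto
      also have "\<dots> < e\<^sup>2" using N e \<open>0 < N\<close> by (simp add: field_simps)
      finally have "(d (s n) (s k))\<^sup>2 < e\<^sup>2" using dist[of n k] by simp
      then show ?thesis using e by (intro power2_less_imp_less[of _ e]) auto
    qed
    then show "\<exists>N. \<forall>n n'. N \<le> n \<longrightarrow> N \<le> n' \<longrightarrow> d (s n) (s n') < e" by blast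
  qed (use s(1) in auto)
  then obtain b where b: "limitin mtopology s b sequentially"
    using complete by (auto simp: mcomplete_def)
  then have bM: "b \<in> M" by (simp add: limitin_metric)
  have lim: "(\<lambda>n. d b (s n)) \<longlonglongrightarrow> 0"
    unfolding LIMSEQ_iff
  proof (intro allI impI)
    fix r :: real assume "r > 0"
    then obtain N where "\<forall>n\<ge>N. s n \<in> M \<and> d (s n) b < r"
      using b unfolding limit_metric_sequentially by blast
    then show "\<exists>no. \<forall>n\<ge>no. norm (d b (s n) - 0) < r"
      by (intro exI[of _ N]) (simp add: commute[of b])
  qed
  define I where "I = (\<integral>\<omega>. d b (f \<omega>) \<partial>P)"
  have "(\<lambda>n. (v + 1 / Suc n) + d b (s n) * (2 * I + d b (s n))) \<longlonglongrightarrow> (v + 0) + 0 * (2 * I + 0)"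
    by (intro tendsto_intros lim LIMSEQ_Suc[OF lim_1_over_n])
  moreover have "spread P f b \<le> (v + 1 / Suc n) + d b (s n) * (2 * I + d b (s n))" for n
    using spread_continuous_bound[OF f bM s(1), of n] s(2)[of n] by (simp add: I_def)
  ultimately have "spread P f b \<le> v"
    by (intro LIMSEQ_le_const[of _ v "spread P f b"]) auto
  then show ?thesis using v bM unfolding minimizes_spread_def by (intro exI[of _ b]) force
qed

text \<open>
  Adding the variance inequalities for both maps leaves the integral of a \<open>quad\<close> term, which is bilinear in
  the two displacements and therefore bounded by \<open>d a b\<close> times \<open>D\<close>. Comparing the minimal values alone would
  only give Hoelder continuity of exponent \<open>1/2\<close>.
\<close>

theorem minimizes_spread_Lipschitz:
  assumes f: "square_integrable_map P f" and g: "square_integrable_map P g"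
    and bf: "minimizes_spread P f a" and bg: "minimizes_spread P g b"
    and D: "AE \<omega> in P. d (f \<omega>) (g \<omega>) \<le> D"
  shows "d a b \<le> 3 * D"
proof -
  interpret prob_space P using f by (simp add: square_integrable_map_def)
  have ab: "a \<in> M" "b \<in> M" using bf bg by (auto simp: minimizes_spread_def)
  have int: "integrable P (\<lambda>\<omega>. (d z (f \<omega>))\<^sup>2)" "integrable P (\<lambda>\<omega>. (d z (g \<omega>))\<^sup>2)" if "z \<in> M" for z
    using f g that by (auto simp: square_integrable_map_def)
  have "2 * (d a b)\<^sup>2 \<le> 2 * (spread P f b - spread P f a + spread P g a - spread P g b)"
    using variance_inequality[OF f bf ab(2)] variance_inequality[OF g bg ab(1)] by (simp add: commute)
  also have "spread P f b - spread P f a + spread P g a - spread P g b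
      = (\<integral>\<omega>. quad a b (f \<omega>) (g \<omega>) \<partial>P)"
    using int ab by (simp add: spread_def quad_def)
  also have "\<dots> \<le> (\<integral>\<omega>. 3 * d a b * D \<partial>P)"
  proof (rule integral_mono_AE)
    show "integrable P (\<lambda>\<omega>. quad a b (f \<omega>) (g \<omega>))"
      unfolding quad_def using int ab by auto
    show "AE \<omega> in P. quad a b (f \<omega>) (g \<omega>) \<le> 3 * d a b * D"
      using D
    proof (rule AE_mp, intro AE_I2 impI)
      fix \<omega> assume \<omega>: "\<omega> \<in> space P" "d (f \<omega>) (g \<omega>) \<le> D"
      then have "quad a b (f \<omega>) (g \<omega>) \<le> 3 * d a b * d (f \<omega>) (g \<omega>)"
        using f g ab by (intro quad_le) (auto simp: square_integrable_map_def)
      also have "\<dots> \<le> 3 * d a b * D" using \<omega> by (intro mult_left_mono) auto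
      finally show "quad a b (f \<omega>) (g \<omega>) \<le> 3 * d a b * D" .
    qed
  qed auto
  finally have "d a b * d a b \<le> d a b * (3 * D)"
    by (simp add: prob_space power2_eq_square mult_ac)
  moreover have "0 \<le> D"
  proof -
    have "AE \<omega> in P. 0 \<le> D"
      using D by eventually_elim (rule order_trans[OF nonneg])
    then show ?thesis by simp
  qed
  ultimately show ?thesis
    using nonneg[of a b] by (cases "d a b = 0") (simp_all add: mult_le_cancel_left less_le)
qed

end

section \<open>The Gaussian manifold is complete and nonpositively curved\<close>

lemma gauss_manifoldI [simp]: "(m, A) \<in> gauss_manifold \<longleftrightarrow> A \<in> SPD"
  by (simp add: gauss_manifold_def)

text \<open>
  In the chart centered at the midpoint \<open>c\<close> of \<open>p\<close> and \<open>q\<close> the point \<open>c\<close> is the Euclidean midpoint. Distances to \<open>c\<close> and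
  the distance of \<open>p\<close> and \<open>q\<close> are Euclidean there, and all others are at least Euclidean. The Euclidean
  parallelogram law therefore becomes the CN inequality.
\<close>

lemma gauss_dist_CN:
  fixes p q :: "'d::finite gpoint"
  assumes p: "p \<in> gauss_manifold" and q: "q \<in> gauss_manifold"
  shows "\<exists>c\<in>gauss_manifold. \<forall>z\<in>gauss_manifold. (gauss_dist z c)\<^sup>2
    \<le> (gauss_dist z p)\<^sup>2 / 2 + (gauss_dist z q)\<^sup>2 / 2 - (gauss_dist p q)\<^sup>2 / 4"
proof -
  have "snd p \<in> SPD" "snd q \<in> SPD" using assms by (auto simp: gauss_manifold_def)
  then obtain G :: "real^'d^'d" and x where G: "invertible G"
    "snd p = G ** diag_mat (\<lambda>i. exp (x i)) ** transpose G"
    "snd q = G ** diag_mat (\<lambda>i. exp (- x i)) ** transpose G"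
    by (rule SPD_simultaneous_diag)
  have pq: "p = (fst p, G ** diag_mat (\<lambda>i. exp (x i)) ** transpose G)"
    "q = (fst q, G ** diag_mat (\<lambda>i. exp (- x i)) ** transpose G)" by (simp_all add: prod_eq_iff G)
  obtain H where H: "G ** H = mat 1" "H ** G = mat 1" using G(1) by (auto simp: invertible_def)
  then have invH: "invertible H" by (auto simp: invertible_def)
  define c where "c = ((1/2) *\<^sub>R (fst p + fst q), G ** diag_mat (\<lambda>i. exp 0) ** transpose G)"
  have cM: "c \<in> gauss_manifold"
    unfolding c_def gauss_manifoldI by (intro SPD_congruence diag_mat_SPD G(1)) simp
  have chart: "H ** (G ** diag_mat (\<lambda>i. exp (y i)) ** transpose G) ** transpose H = conj_diag (mat 1) (\<lambda>i. exp (y i))" for y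
  proof -
    have "H ** (G ** diag_mat (\<lambda>i. exp (y i)) ** transpose G) ** transpose H
        = (H ** G) ** diag_mat (\<lambda>i. exp (y i)) ** transpose (H ** G)"
      by (simp only: matrix_transpose_mul matrix_mul_assoc)
    then show ?thesis by (simp only: H(2) conj_diag_def)
  qed
  have log: "matlog (H ** (G ** diag_mat (\<lambda>i. exp (y i)) ** transpose G) ** transpose H) = conj_diag (mat 1) y" for y
    unfolding chart by (subst matlog_conj_diag[OF orthogonal_matrix_id]) auto
  have neg: "conj_diag (mat 1) (\<lambda>i. - x i) = - conj_diag (mat 1 :: real^'d^'d) x"
    "conj_diag (mat 1) (\<lambda>i. 0) = (0 :: real^'d^'d)"
    by (simp_all add: vec_eq_iff conj_diag_component sum_negf)
  have mid: "log_chart H c = (1/2) *\<^sub>R (log_chart H p + log_chart H q)"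
    unfolding log_chart_def c_def fst_conv snd_conv log G(2,3) neg
    by (simp add: prod_eq_iff)
  have pq_le: "gdist p q \<le> norm (log_chart H p - log_chart H q)"
    using gdist_congruence_diag_le_log_chart[OF G(1) orthogonal_matrix_id H(2), of "fst p" x "fst q" "\<lambda>i. - x i"]
    unfolding pq(1)[symmetric] pq(2)[symmetric] .
  \<comment> \<open>A point \<open>z\<close> and the center of the chart are diagonalized by one congruence, because an orthogonal
    change of basis fixes the center.\<close>
  have zc_le: "gdist z c \<le> norm (log_chart H z - log_chart H c)" if z: "z \<in> gauss_manifold" for z
  proof -
    have zS: "snd z \<in> SPD" using z by (auto simp: gauss_manifold_def)
    obtain U a where U: "orthogonal_matrix U" "\<And>i. 0 < a i" and eq: "H ** snd z ** transpose H = conj_diag U a"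
      using obtain_SPD_conj_diag[OF SPD_congruence[OF zS invH]] by blast
    define K where "K = G ** U"
    have "snd z = (G ** H) ** snd z ** transpose (G ** H)"
      by (simp add: H(1) transpose_mat)
    also have "\<dots> = G ** (H ** snd z ** transpose H) ** transpose G"
      by (simp only: matrix_transpose_mul matrix_mul_assoc)
    also have "\<dots> = K ** diag_mat a ** transpose K"
      by (simp only: eq conj_diag_def K_def matrix_transpose_mul matrix_mul_assoc)
    finally have z_eq: "z = (fst z, K ** diag_mat (\<lambda>i. exp (ln (a i))) ** transpose K)"
      using U(2) by (simp add: prod_eq_iff)
    have "K ** diag_mat (\<lambda>i. exp 0) ** transpose K = G ** (U ** transpose U) ** transpose G"
      by (simp add: K_def diag_mat_1 matrix_transpose_mul matrix_mul_assoc)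
    then have c_eq: "c = (fst c, K ** diag_mat (\<lambda>i. exp 0) ** transpose K)"
      by (simp add: c_def orthogonal_matrixD[OF U(1)] diag_mat_1)
    have HK: "H ** K = U" by (simp add: K_def matrix_mul_assoc H(2))
    have "invertible K"
      unfolding K_def by (rule invertible_mult[OF G(1) orthogonal_matrix_invertible[OF U(1)]])
    from gdist_congruence_diag_le_log_chart[OF this U(1) HK, of "fst z" "\<lambda>i. ln (a i)" "fst c" "\<lambda>i. 0"]
    show ?thesis unfolding z_eq[symmetric] c_eq[symmetric] .
  qed
  have "(gauss_dist z c)\<^sup>2 \<le> (gauss_dist z p)\<^sup>2 / 2 + (gauss_dist z q)\<^sup>2 / 2 - (gauss_dist p q)\<^sup>2 / 4"
    if z: "z \<in> gauss_manifold" for z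
  proof -
    interpret Metric_space "gauss_manifold :: 'd gpoint set" gauss_dist by (rule Metric_space_gauss_dist)
    let ?z = "log_chart H z" and ?p = "log_chart H p" and ?q = "log_chart H q"
    have gd: "gdist u v = gauss_dist u v" if "u \<in> gauss_manifold" "v \<in> gauss_manifold" for u v :: "'d gpoint"
      using that by (simp add: gauss_dist_def)
    have "(gauss_dist z c)\<^sup>2 \<le> (norm (?z - (1/2) *\<^sub>R (?p + ?q)))\<^sup>2"
      using zc_le[OF z] mid nonneg[of z c] gd[OF z cM] by (intro power_mono) auto
    also have "\<dots> = (norm (?z - ?p))\<^sup>2 / 2 + (norm (?z - ?q))\<^sup>2 / 2 - (norm (?p - ?q))\<^sup>2 / 4"
      unfolding power2_norm_eq_inner
      by (simp add: inner_diff_left inner_diff_right inner_add_left inner_add_right inner_commute field_simps)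
    also have "\<dots> \<le> (gauss_dist z p)\<^sup>2 / 2 + (gauss_dist z q)\<^sup>2 / 2 - (gauss_dist p q)\<^sup>2 / 4"
      using log_chart_le_gdist[OF z p invH] log_chart_le_gdist[OF z q invH] pq_le nonneg[of p q]
      unfolding gd[OF z p] gd[OF z q] gd[OF p q]
      by (intro diff_mono add_mono divide_right_mono power_mono) auto
    finally show ?thesis .
  qed
  then show ?thesis using cM by blast
qed

lemma gauss_dist_le_sqchord:
  assumes "p \<in> gauss_manifold" "q \<in> gauss_manifold"
  shows "gauss_dist p q \<le> sqrt (sqchord p q)"
proof -
  obtain H where "invertible H" "gdist p q = norm (log_chart H p - log_chart H q)"
    using gdist_eq_log_chart[OF assms] by blast
  then show ?thesis
    using log_chart_le_sqchord[OF assms] assms by (simp add: gauss_dist_def real_le_rsqrt)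
qed

lemma gauss_dist_matexp_le:
  assumes "X \<in> Sym" "Y \<in> Sym" "norm X \<le> r" "norm Y \<le> r"
  shows "gauss_dist (m, matexp X) (n, matexp Y)
    \<le> sqrt ((norm (m - n))\<^sup>2 + (cosh r)\<^sup>2 * (norm (X - Y))\<^sup>2 / 2)"
proof -
  have "gauss_dist (m, matexp X) (n, matexp Y) \<le> sqrt (sqchord (m, matexp X) (n, matexp Y))"
    using assms by (intro gauss_dist_le_sqchord) (auto simp: matexp_SPD)
  also have "\<dots> \<le> sqrt ((norm (m - n))\<^sup>2 + (cosh r)\<^sup>2 * (norm (X - Y))\<^sup>2 / 2)"
    using chord_matexp_le[OF assms] by (simp add: sqchord_def norm_minus_commute)
  finally show ?thesis .
qed

lemma subspace_Sym: "subspace (Sym :: (real^'n^'n) set)"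
  by (auto simp: subspace_def Sym_def transpose_def vec_eq_iff)

text \<open>
  The chart does not increase distances, so it maps a Cauchy sequence to a convergent one; on the bounded set
  of its values the exponential is Lipschitz and carries the limit back.
\<close>

lemma mcomplete_gauss_dist:
  "Metric_space.mcomplete (gauss_manifold :: 'd::finite gpoint set) gauss_dist"
proof -
  interpret Metric_space "gauss_manifold :: 'd gpoint set" gauss_dist by (rule Metric_space_gauss_dist)
  have "\<exists>l. limitin mtopology s l sequentially" if s: "MCauchy s" for s :: "nat \<Rightarrow> 'd gpoint"
  proof -
    have sM: "s n \<in> gauss_manifold" for n using s by (auto simp: MCauchy_def)
    define L where "L n = log_chart (mat 1) (s n)" for n
    define X where "X n = matlog (snd (s n))" for n
    have SPD: "snd (s n) \<in> SPD" for n using sM[of n] by (auto simp: gauss_manifold_def)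
    have L: "L n = (fst (s n), (1 / sqrt 2) *\<^sub>R X n)" for n
      by (simp add: L_def log_chart_def X_def transpose_mat)
    have "Cauchy L"
      unfolding Cauchy_def
    proof (intro allI impI)
      fix e :: real assume "e > 0"
      then obtain N where N: "\<And>n n'. N \<le> n \<Longrightarrow> N \<le> n' \<Longrightarrow> gauss_dist (s n) (s n') < e"
        using s unfolding MCauchy_def by blast
      have "dist (L n) (L n') < e" if "N \<le> n" "N \<le> n'" for n n'
      proof -
        have "invertible (mat 1 :: real^'d^'d)" by (simp add: invertible_right_inverse)
        then have "dist (L n) (L n') \<le> gauss_dist (s n) (s n')"
          using log_chart_le_gdist[OF sM sM] sM by (simp add: L_def gauss_dist_def dist_norm)
        with N[OF that] show ?thesis by linarith
      qed
      then show "\<exists>M. \<forall>m\<ge>M. \<forall>n\<ge>M. dist (L m) (L n) < e" by blast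
    qed
    then obtain l where l: "L \<longlonglongrightarrow> l" using Cauchy_convergent_iff convergent_def by blast
    define Y where "Y = sqrt 2 *\<^sub>R snd l"
    have fst_lim: "(\<lambda>n. fst (s n)) \<longlonglongrightarrow> fst l"
      using tendsto_fst[OF l] by (simp add: L)
    have X_lim: "X \<longlonglongrightarrow> Y"
      using tendsto_scaleR[OF tendsto_const tendsto_snd[OF l], of "sqrt 2"] by (simp add: L Y_def)
    have X_Sym: "X n \<in> Sym" for n using SPD by (simp add: X_def matlog_Sym)
    have Y_Sym: "Y \<in> Sym"
      using closed_subspace[OF subspace_Sym] X_lim X_Sym closed_sequentially by blast
    obtain r0 where r0: "\<And>n. norm (X n) \<le> r0"
      using convergent_imp_Bseq[OF convergentI[OF X_lim]] by (auto simp: Bseq_def)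
    define r where "r = max r0 (norm Y)"
    define p where "p = (fst l, matexp Y)"
    have pM: "p \<in> gauss_manifold" using Y_Sym by (simp add: p_def matexp_SPD)
    have bound: "gauss_dist (s n) p \<le> sqrt ((norm (fst (s n) - fst l))\<^sup>2 + (cosh r)\<^sup>2 * (norm (X n - Y))\<^sup>2 / 2)" for n
    proof -
      have "s n = (fst (s n), matexp (X n))"
        using SPD[of n] by (simp add: X_def matexp_matlog)
      moreover have "norm (X n) \<le> r" "norm Y \<le> r" using r0[of n] by (auto simp: r_def)
      ultimately show ?thesis
        unfolding p_def using gauss_dist_matexp_le[OF X_Sym Y_Sym, of n r] by metis
    qed
    have "(\<lambda>n. sqrt ((norm (fst (s n) - fst l))\<^sup>2 + (cosh r)\<^sup>2 * (norm (X n - Y))\<^sup>2 / 2))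
        \<longlonglongrightarrow> sqrt ((norm (fst l - fst l))\<^sup>2 + (cosh r)\<^sup>2 * (norm (Y - Y))\<^sup>2 / 2)"
      by (intro tendsto_intros fst_lim X_lim) auto
    then have lim: "(\<lambda>n. sqrt ((norm (fst (s n) - fst l))\<^sup>2 + (cosh r)\<^sup>2 * (norm (X n - Y))\<^sup>2 / 2)) \<longlonglongrightarrow> 0"
      by simp
    have "limitin mtopology s p sequentially"
      unfolding limitin_metric
    proof (intro conjI allI impI pM)
      fix e :: real assume "e > 0"
      from order_tendstoD(2)[OF lim this]
      show "\<forall>\<^sub>F n in sequentially. s n \<in> gauss_manifold \<and> gauss_dist (s n) p < e"
        by eventually_elim (use bound sM in \<open>auto intro: le_less_trans\<close>)
    qed
    then show ?thesis by blast
  qed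
  then show ?thesis by (simp add: mcomplete_def)
qed

theorem cn_space_gauss_dist: "cn_space (gauss_manifold :: 'd::finite gpoint set) gauss_dist"
proof -
  interpret Metric_space "gauss_manifold :: 'd gpoint set" gauss_dist by (rule Metric_space_gauss_dist)
  show ?thesis by unfold_locales (auto intro: gauss_dist_CN mcomplete_gauss_dist)
qed

section \<open>Measurability\<close>

text \<open>
  The distance is continuous for the topology of the coordinates, because \<open>sqchord\<close> is. This makes it Borel measurable.
\<close>

lemma continuous_on_gauss_dist:
  assumes y: "y \<in> gauss_manifold"
  shows "continuous_on gauss_manifold (gauss_dist (y :: 'd::finite gpoint))"
  unfolding continuous_on_def
proof
  interpret Metric_space "gauss_manifold :: 'd gpoint set" gauss_dist by (rule Metric_space_gauss_dist)
  fix p :: "'d gpoint" assume p: "p \<in> gauss_manifold"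
  have "((\<lambda>q. q) \<longlongrightarrow> p) (at p within gauss_manifold)" by (rule tendsto_ident_at)
  from tendsto_real_sqrt[OF tendsto_sqchord_0[OF this p]]
  have "((\<lambda>q. sqrt (sqchord p q)) \<longlongrightarrow> 0) (at p within gauss_manifold)" by simp
  moreover have "\<bar>gauss_dist y q - gauss_dist y p\<bar> \<le> sqrt (sqchord p q)" if "q \<in> gauss_manifold" for q
    using triangle[OF y p that] triangle[OF y that p] gauss_dist_le_sqchord[OF p that] commute[of p q]
    by linarith
  ultimately have "((\<lambda>q. gauss_dist y q - gauss_dist y p) \<longlongrightarrow> 0) (at p within gauss_manifold)"
    by (elim Lim_null_comparison[rotated]) (auto simp: eventually_at_filter)
  then show "(gauss_dist y \<longlongrightarrow> gauss_dist y p) (at p within gauss_manifold)"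
    by (rule LIM_zero_cancel)
qed

lemma space_gauss_borel [simp]: "space gauss_borel = gauss_manifold"
  by (simp add: gauss_borel_def space_restrict_space)

lemma gauss_dist_measurable:
  "y \<in> gauss_manifold \<Longrightarrow> gauss_dist y \<in> borel_measurable gauss_borel"
  unfolding gauss_borel_def
  by (intro borel_measurable_continuous_on_restrict continuous_on_gauss_dist)

lemma gdist_measurable:
  assumes "y \<in> gauss_manifold"
  shows "gdist y \<in> borel_measurable gauss_borel"
  using gauss_dist_measurable[OF assms]
  by (rule measurable_cong[THEN iffD1, rotated]) (simp add: gauss_dist_def assms)

lemma matexp_measurable: "matexp \<in> borel_measurable (borel :: (real^'n^'n) measure)"
proof -
  have "continuous_on UNIV (\<lambda>A :: real^'n^'n. matpow A k)" for k
    by (induction k) (auto intro!: continuous_intros bounded_bilinear.continuous_on[OF bounded_bilinear_matrix_mult])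
  then have "(\<lambda>A :: real^'n^'n. (1 / fact k) *\<^sub>R matpow A k) \<in> borel_measurable borel" for k
    by (intro borel_measurable_continuous_onI continuous_intros)
  then show ?thesis
    unfolding matexp_def[abs_def] by (rule borel_measurable_suminf)
qed

section \<open>Lipschitz dependence of drift and log-covariance on the path\<close>

lemma norm_weighted_sum_le:
  fixes f :: "nat \<Rightarrow> 'a::real_normed_vector"
  assumes \<kappa>: "volterra_kernel \<kappa>" and f: "\<And>r. r \<le> t \<Longrightarrow> norm (f r) \<le> B" and "0 \<le> B"
  shows "norm (\<Sum>r=0..t. \<kappa> t r *\<^sub>R f r) \<le> B"
proof -
  have "norm (\<Sum>r=0..t. \<kappa> t r *\<^sub>R f r) \<le> (\<Sum>r=0..t. \<kappa> t r * B)"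
  proof (rule order_trans[OF norm_sum], rule sum_mono)
    fix r assume "r \<in> {0..t}"
    then show "norm (\<kappa> t r *\<^sub>R f r) \<le> \<kappa> t r * B"
      using \<kappa> f[of r] by (auto simp: volterra_kernel_def intro!: mult_left_mono)
  qed
  also have "\<dots> = (\<Sum>r=0..t. \<kappa> t r) * B" by (simp add: sum_distrib_right)
  also have "\<dots> \<le> 1 * B"
    using \<kappa> \<open>0 \<le> B\<close> by (intro mult_right_mono) (auto simp: volterra_kernel_def)
  finally show ?thesis by simp
qed

lemma norm_diff_le_path_dist: "r \<le> t \<Longrightarrow> norm (x r - y r) \<le> path_dist t x y"
  unfolding path_dist_def by (rule member_le_L2_set) auto

lemma path_dist_nonneg: "0 \<le> path_dist t x y"
  by (simp add: path_dist_def L2_set_nonneg)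

lemma weighted_sum_Lipschitz:
  fixes g :: "real \<times> (real^'d) \<Rightarrow> 'b::real_normed_vector"
  assumes lip: "L-lipschitz_on UNIV g" and \<kappa>: "volterra_kernel \<kappa>"
  shows "norm ((\<Sum>r=0..t. \<kappa> t r *\<^sub>R g (real t, x r)) - (\<Sum>r=0..t. \<kappa> t r *\<^sub>R g (real t, y r)))
    \<le> L * path_dist t x y"
proof -
  have L: "0 \<le> L" using lip by (rule lipschitz_on_nonneg)
  have "(\<Sum>r=0..t. \<kappa> t r *\<^sub>R g (real t, x r)) - (\<Sum>r=0..t. \<kappa> t r *\<^sub>R g (real t, y r))
      = (\<Sum>r=0..t. \<kappa> t r *\<^sub>R (g (real t, x r) - g (real t, y r)))"
    by (simp add: sum_subtractf scaleR_diff_right)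
  also have "norm \<dots> \<le> L * path_dist t x y"
  proof (rule norm_weighted_sum_le[OF \<kappa>])
    fix r assume "r \<le> t"
    have "norm (g (real t, x r) - g (real t, y r)) \<le> L * norm (x r - y r)"
      using lipschitz_onD[OF lip, of "(real t, x r)" "(real t, y r)"] by (simp add: dist_Pair_Pair dist_norm)
    also have "\<dots> \<le> L * path_dist t x y"
      using norm_diff_le_path_dist[OF \<open>r \<le> t\<close>] L by (intro mult_left_mono)
    finally show "norm (g (real t, x r) - g (real t, y r)) \<le> L * path_dist t x y" .
  next
    show "0 \<le> L * path_dist t x y" using L path_dist_nonneg by (rule mult_nonneg_nonneg)
  qed
  finally show ?thesis .
qed

lemma drift_Lipschitz:
  assumes "L-lipschitz_on UNIV \<mu>" "volterra_kernel \<kappa>"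
  shows "norm (drift \<kappa> \<mu> t x - drift \<kappa> \<mu> t y) \<le> L * path_dist t x y"
  unfolding drift_def by (rule weighted_sum_Lipschitz[OF assms])

lemma log_covariance_Lipschitz:
  assumes "L-lipschitz_on UNIV \<sigma>" "volterra_kernel \<kappa>"
  shows "norm (log_covariance \<kappa> \<sigma> t x s - log_covariance \<kappa> \<sigma> t y s) \<le> L * path_dist t x y"
  using weighted_sum_Lipschitz[OF assms, of t x y]
  by (simp add: log_covariance_def scaleR_add_right sum.distrib)

lemma log_covariance_Sym:
  assumes "\<And>z. \<sigma> z \<in> Sym" "\<And>r. s r \<in> Sym"
  shows "log_covariance \<kappa> \<sigma> t x s \<in> Sym"
  unfolding log_covariance_def
  by (intro subspace_sum[OF subspace_Sym] subspace_scale[OF subspace_Sym] subspace_add[OF subspace_Sym] assms)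

lemma log_covariance_bound:
  assumes "volterra_kernel \<kappa>" "\<And>x. norm (\<sigma> (real t, x)) \<le> M" "\<And>r. norm (s r) \<le> R"
  shows "norm (log_covariance \<kappa> \<sigma> t x s) \<le> M + R"
  unfolding log_covariance_def
proof (rule norm_weighted_sum_le[OF assms(1)])
  show "norm (\<sigma> (real t, x r) + s r) \<le> M + R" for r
    using norm_triangle_ineq[of "\<sigma> (real t, x r)" "s r"] assms(2)[of "x r"] assms(3)[of r] by linarith
  then show "0 \<le> M + R" using norm_ge_zero order_trans by blast
qed

section \<open>Barycenters of image measures\<close>

lemma finite_first_moment_distr:
  fixes f :: "'w \<Rightarrow> 'd::finite gpoint"
  assumes P: "prob_space P" and f: "f \<in> measurable P gauss_borel"
    and sq: "cn_space.square_integrable_map gauss_manifold gauss_dist P f"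
  shows "finite_first_moment (distr P gauss_borel f)"
proof -
  interpret prob_space P by (rule P)
  interpret cn_space "gauss_manifold :: 'd gpoint set" gauss_dist by (rule cn_space_gauss_dist)
  have fM: "f \<omega> \<in> gauss_manifold" if "\<omega> \<in> space P" for \<omega>
    using measurable_space[OF f that] by simp
  have "integrable (distr P gauss_borel f) (gdist y)" if y: "y \<in> gauss_manifold" for y
  proof -
    have "integrable P (\<lambda>\<omega>. gauss_dist y (f \<omega>))"
      using sq y by (intro integrable_dist_map)
    then have "integrable P (\<lambda>\<omega>. gdist y (f \<omega>))"
      by (rule Bochner_Integration.integrable_cong[THEN iffD1, rotated -1]) (auto simp: gauss_dist_def y fM)
    then show ?thesis
      by (subst integrable_distr_eq[OF f gdist_measurable[OF y]])
  qed
  then show ?thesis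
    unfolding finite_first_moment_def using prob_space_distr[OF f] by simp
qed

lemma gdist_square_distr:
  fixes f :: "'w \<Rightarrow> 'd::finite gpoint"
  assumes f: "f \<in> measurable P gauss_borel"
    and sq: "cn_space.square_integrable_map gauss_manifold gauss_dist P f"
    and u: "u \<in> gauss_manifold"
  shows "integrable (distr P gauss_borel f) (\<lambda>v. (gdist u v)\<^sup>2)"
    and "(\<integral>v. (gdist u v)\<^sup>2 \<partial>distr P gauss_borel f) = cn_space.spread gauss_dist P f u"
proof -
  interpret cn_space "gauss_manifold :: 'd gpoint set" gauss_dist by (rule cn_space_gauss_dist)
  have fM: "f \<omega> \<in> gauss_manifold" if "\<omega> \<in> space P" for \<omega>
    using measurable_space[OF f that] by simp
  have meas: "(\<lambda>v. (gdist u v)\<^sup>2) \<in> borel_measurable gauss_borel"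
    using gdist_measurable[OF u] by simp
  have eq: "(gdist u (f \<omega>))\<^sup>2 = (gauss_dist u (f \<omega>))\<^sup>2" if "\<omega> \<in> space P" for \<omega>
    using fM[OF that] u by (simp add: gauss_dist_def)
  have "integrable P (\<lambda>\<omega>. (gdist u (f \<omega>))\<^sup>2)"
    using sq u unfolding square_integrable_map_def
    by (subst Bochner_Integration.integrable_cong[OF refl eq]) auto
  then show "integrable (distr P gauss_borel f) (\<lambda>v. (gdist u v)\<^sup>2)"
    by (subst integrable_distr_eq[OF f meas])
  show "(\<integral>v. (gdist u v)\<^sup>2 \<partial>distr P gauss_borel f) = spread P f u"
    unfolding spread_def integral_distr[OF f meas]
    by (rule Bochner_Integration.integral_cong[OF refl eq])
qed

text \<open>
  For a square integrable law, subtracting the constant \<open>\<integral>x. (gdist y x)\<^sup>2\<close> does not affect the minimization, so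
  both notions of minimizer agree.
\<close>

lemma
  fixes f :: "'w \<Rightarrow> 'd::finite gpoint"
  assumes f: "f \<in> measurable P gauss_borel"
    and sq: "cn_space.square_integrable_map gauss_manifold gauss_dist P f"
  shows is_arg_min_iff_minimizes_spread:
      "is_arg_min (\<lambda>u. \<integral>v. (gdist u v)\<^sup>2 \<partial>distr P gauss_borel f) (\<lambda>u. u \<in> gauss_manifold) z
        \<longleftrightarrow> cn_space.minimizes_spread gauss_manifold gauss_dist P f z"
    and is_barycenter_iff_minimizes_spread:
      "is_barycenter (distr P gauss_borel f) z
        \<longleftrightarrow> cn_space.minimizes_spread gauss_manifold gauss_dist P f z"
proof -
  interpret cn_space "gauss_manifold :: 'd gpoint set" gauss_dist by (rule cn_space_gauss_dist)
  note int = gdist_square_distr[OF f sq]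
  show "is_arg_min (\<lambda>u. \<integral>v. (gdist u v)\<^sup>2 \<partial>distr P gauss_borel f) (\<lambda>u. u \<in> gauss_manifold) z
        \<longleftrightarrow> minimizes_spread P f z"
    unfolding is_arg_min_linorder minimizes_spread_def by (auto simp: int(2))
  have diff: "(\<integral>x. ((gdist u x)\<^sup>2 - (gdist y x)\<^sup>2) \<partial>distr P gauss_borel f) = spread P f u - spread P f y"
    if "u \<in> gauss_manifold" "y \<in> gauss_manifold" for u y
    using that by (simp add: int)
  have "(mat 1 :: real^'d^'d) \<in> SPD"
    using diag_mat_SPD[of "\<lambda>_::'d. 1"] by (simp add: diag_mat_1)
  then have base: "((0, mat 1) :: 'd gpoint) \<in> gauss_manifold" by simp
  have "(\<forall>u. u \<in> gauss_manifold \<longrightarrow>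
      (\<integral>x. ((gdist z x)\<^sup>2 - (gdist y x)\<^sup>2) \<partial>distr P gauss_borel f)
        \<le> (\<integral>x. ((gdist u x)\<^sup>2 - (gdist y x)\<^sup>2) \<partial>distr P gauss_borel f))
    \<longleftrightarrow> (\<forall>u\<in>gauss_manifold. spread P f z \<le> spread P f u)"
    if "z \<in> gauss_manifold" "y \<in> gauss_manifold" for y
    using that by (auto simp: diff)
  then show "is_barycenter (distr P gauss_borel f) z \<longleftrightarrow> minimizes_spread P f z"
    unfolding is_barycenter_def is_arg_min_linorder minimizes_spread_def
    using base by blast
qed

section \<open>The Gaussian random projection\<close>

lemma Psi_measurable:
  fixes \<sigma> :: "real \<times> (real^'d::finite) \<Rightarrow> real^'d^'d"
  assumes \<sigma>: "\<And>z. \<sigma> z \<in> Sym" and S: "\<And>n \<omega>. \<omega> \<in> space P \<Longrightarrow> S n \<omega> \<in> Sym"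
    and S_meas: "\<And>n. S n \<in> borel_measurable P"
  shows "(\<lambda>\<omega>. Psi \<mu> \<sigma> \<kappa> t x (\<lambda>r. S r \<omega>)) \<in> measurable P gauss_borel"
  unfolding gauss_borel_def
proof (rule measurable_restrict_space2)
  show "(\<lambda>\<omega>. Psi \<mu> \<sigma> \<kappa> t x (\<lambda>r. S r \<omega>)) \<in> space P \<rightarrow> gauss_manifold"
    using \<sigma> S by (auto simp: Psi_def intro!: matexp_SPD log_covariance_Sym)
  have "(\<lambda>\<omega>. log_covariance \<kappa> \<sigma> t x (\<lambda>r. S r \<omega>)) \<in> borel_measurable P"
    unfolding log_covariance_def using S_meas by measurable
  from measurable_compose[OF this matexp_measurable]
  show "(\<lambda>\<omega>. Psi \<mu> \<sigma> \<kappa> t x (\<lambda>r. S r \<omega>)) \<in> borel_measurable P"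
    unfolding Psi_def by (intro borel_measurable_Pair) auto
qed

text \<open>
  The law is concentrated on a bounded set: the log-covariance is a subconvex combination of matrices of
  norm at most \<open>M + R\<close>, and the mean is deterministic.
\<close>

lemma Psi_square_integrable:
  fixes \<sigma> :: "real \<times> (real^'d::finite) \<Rightarrow> real^'d^'d"
  assumes P: "prob_space P" and \<kappa>: "volterra_kernel \<kappa>"
    and \<sigma>: "\<And>z. \<sigma> z \<in> Sym" and S: "\<And>n \<omega>. \<omega> \<in> space P \<Longrightarrow> S n \<omega> \<in> Sym"
    and S_meas: "\<And>n. S n \<in> borel_measurable P"
    and S_bound: "AE \<omega> in P. \<forall>r. norm (S r \<omega>) \<le> R" and \<sigma>_bound: "\<And>x. norm (\<sigma> (real t, x)) \<le> M"
  shows "cn_space.square_integrable_map gauss_manifold gauss_dist P (\<lambda>\<omega>. Psi \<mu> \<sigma> \<kappa> t x (\<lambda>r. S r \<omega>))"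
proof -
  interpret prob_space P by (rule P)
  interpret cn_space "gauss_manifold :: 'd gpoint set" gauss_dist by (rule cn_space_gauss_dist)
  let ?f = "\<lambda>\<omega>. Psi \<mu> \<sigma> \<kappa> t x (\<lambda>r. S r \<omega>)"
  have f: "?f \<in> measurable P gauss_borel"
    by (rule Psi_measurable) (use \<sigma> S S_meas in auto)
  have fM: "?f \<omega> \<in> gauss_manifold" if "\<omega> \<in> space P" for \<omega>
    using measurable_space[OF f that] by simp
  define base :: "'d gpoint" where "base = (0, matexp 0)"
  have zero: "(0 :: real^'d^'d) \<in> Sym" by (rule subspace_0[OF subspace_Sym])
  have oM: "base \<in> gauss_manifold" by (simp add: base_def matexp_SPD zero)
  define B where "B = sqrt ((norm (- (x t + drift \<kappa> \<mu> t x)))\<^sup>2 + (cosh (M + R))\<^sup>2 * (M + R)\<^sup>2 / 2)"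
  have bnd: "AE \<omega> in P. gauss_dist base (?f \<omega>) \<le> B"
    using S_bound
  proof (rule AE_mp, intro AE_I2 impI)
    fix \<omega> assume \<omega>: "\<omega> \<in> space P" "\<forall>r. norm (S r \<omega>) \<le> R"
    let ?X = "log_covariance \<kappa> \<sigma> t x (\<lambda>r. S r \<omega>)"
    have X: "norm ?X \<le> M + R" using \<kappa> \<sigma>_bound \<omega>(2) by (intro log_covariance_bound) auto
    have XS: "?X \<in> Sym" using \<sigma> S \<omega>(1) by (intro log_covariance_Sym) auto
    have "gauss_dist base (?f \<omega>) \<le> sqrt ((norm (0 - (x t + drift \<kappa> \<mu> t x)))\<^sup>2 + (cosh (M + R))\<^sup>2 * (norm (0 - ?X))\<^sup>2 / 2)"
      unfolding base_def Psi_def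
      using X order_trans[OF norm_ge_zero X] by (intro gauss_dist_matexp_le zero XS) auto
    also have "\<dots> \<le> B"
      unfolding B_def using X by (intro real_sqrt_le_mono add_mono divide_right_mono mult_left_mono) (auto intro: power_mono)
    finally show "gauss_dist base (?f \<omega>) \<le> B" .
  qed
  show ?thesis
    unfolding square_integrable_map_def
  proof (intro conjI ballI P)
    fix z :: "'d gpoint" assume z: "z \<in> gauss_manifold"
    show meas: "(\<lambda>\<omega>. gauss_dist z (?f \<omega>)) \<in> borel_measurable P"
      by (rule measurable_compose[OF f gauss_dist_measurable[OF z]])
    show "integrable P (\<lambda>\<omega>. (gauss_dist z (?f \<omega>))\<^sup>2)"
    proof (rule integrable_const_bound[where B = "(gauss_dist z base + B)\<^sup>2"])
      show "AE \<omega> in P. norm ((gauss_dist z (?f \<omega>))\<^sup>2) \<le> (gauss_dist z base + B)\<^sup>2"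
        using bnd
      proof (rule AE_mp, intro AE_I2 impI)
        fix \<omega> assume "\<omega> \<in> space P" "gauss_dist base (?f \<omega>) \<le> B"
        then have "gauss_dist z (?f \<omega>) \<le> gauss_dist z base + B"
          using triangle[OF z oM fM] by fastforce
        then show "norm ((gauss_dist z (?f \<omega>))\<^sup>2) \<le> (gauss_dist z base + B)\<^sup>2"
          using nonneg by (simp add: power_mono)
      qed
      show "(\<lambda>\<omega>. (gauss_dist z (?f \<omega>))\<^sup>2) \<in> borel_measurable P" using meas by simp
    qed
  qed (rule fM)
qed

text \<open>
  The constant does not depend on \<open>s\<close>, so that the estimate can be fed into the stability of the
  barycenter pathwise, for the coupling of the two laws by the same environment.
\<close>

lemma Psi_Lipschitz:
  fixes \<sigma> :: "real \<times> (real^'d::finite) \<Rightarrow> real^'d^'d"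
  assumes \<kappa>: "volterra_kernel \<kappa>" and \<sigma>: "\<And>z. \<sigma> z \<in> Sym" and s: "\<And>r. s r \<in> Sym"
    and s_bound: "\<And>r. norm (s r) \<le> R" and \<sigma>_bound: "\<And>x. norm (\<sigma> (real t, x)) \<le> M"
    and lip: "L\<mu>-lipschitz_on UNIV \<mu>" "L\<sigma>-lipschitz_on UNIV \<sigma>"
  shows "gauss_dist (Psi \<mu> \<sigma> \<kappa> t x s) (Psi \<mu> \<sigma> \<kappa> t y s)
    \<le> sqrt ((1 + L\<mu>)\<^sup>2 + (cosh (M + R))\<^sup>2 * L\<sigma>\<^sup>2 / 2) * path_dist t x y"
proof -
  let ?X = "log_covariance \<kappa> \<sigma> t x s" and ?Y = "log_covariance \<kappa> \<sigma> t y s" and ?D = "path_dist t x y"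
  let ?m = "x t + drift \<kappa> \<mu> t x" and ?n = "y t + drift \<kappa> \<mu> t y"
  have L: "0 \<le> L\<mu>" "0 \<le> L\<sigma>" using lip by (auto dest: lipschitz_on_nonneg)
  have "norm (?m - ?n) \<le> norm (x t - y t) + norm (drift \<kappa> \<mu> t x - drift \<kappa> \<mu> t y)"
    using norm_triangle_ineq[of "x t - y t" "drift \<kappa> \<mu> t x - drift \<kappa> \<mu> t y"] by (simp add: algebra_simps)
  also have "\<dots> \<le> ?D + L\<mu> * ?D"
    by (intro add_mono norm_diff_le_path_dist drift_Lipschitz lip \<kappa>) simp
  finally have m: "norm (?m - ?n) \<le> (1 + L\<mu>) * ?D" by (simp add: algebra_simps)
  have X: "norm (?X - ?Y) \<le> L\<sigma> * ?D" by (rule log_covariance_Lipschitz[OF lip(2) \<kappa>])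
  have "gauss_dist (Psi \<mu> \<sigma> \<kappa> t x s) (Psi \<mu> \<sigma> \<kappa> t y s)
      \<le> sqrt ((norm (?m - ?n))\<^sup>2 + (cosh (M + R))\<^sup>2 * (norm (?X - ?Y))\<^sup>2 / 2)"
    unfolding Psi_def
    by (intro gauss_dist_matexp_le log_covariance_Sym log_covariance_bound \<kappa> \<sigma> s s_bound \<sigma>_bound)
  also have "\<dots> \<le> sqrt (((1 + L\<mu>) * ?D)\<^sup>2 + (cosh (M + R))\<^sup>2 * (L\<sigma> * ?D)\<^sup>2 / 2)"
    using m X by (intro real_sqrt_le_mono add_mono divide_right_mono mult_left_mono power_mono) auto
  also have "\<dots> = sqrt (((1 + L\<mu>)\<^sup>2 + (cosh (M + R))\<^sup>2 * L\<sigma>\<^sup>2 / 2) * ?D\<^sup>2)"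
    unfolding power_mult_distrib by (simp add: distrib_right mult.assoc)
  also have "\<dots> = sqrt ((1 + L\<mu>)\<^sup>2 + (cosh (M + R))\<^sup>2 * L\<sigma>\<^sup>2 / 2) * ?D"
    by (simp add: real_sqrt_mult path_dist_nonneg)
  finally show ?thesis .
qed

theorem theorem8:
  fixes t :: nat and R M L\<mu> L\<sigma> :: real
  assumes "R > 0" and "M > 0"
  shows "\<exists>L\<ge>0. \<forall>(P :: 'w measure) (\<mu> :: real \<times> (real^'d::finite) \<Rightarrow> real^'d) \<sigma> \<kappa> S W x0 X K.
    volterra_setting P L\<mu> L\<sigma> \<mu> \<sigma> \<kappa> S W x0 X \<longrightarrow>
    (AE \<omega> in P. \<forall>s. norm (S s \<omega>) \<le> R) \<longrightarrow>
    (\<forall>(s::nat) x. norm (\<sigma> (real s, x)) \<le> M) \<longrightarrow>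
    compactin (Metric_space.mtopology (path_space t) (path_dist t)) K \<longrightarrow>
    (\<forall>x\<in>K.
       (\<lambda>\<omega>. Psi \<mu> \<sigma> \<kappa> t x (\<lambda>r. S r \<omega>)) \<in> measurable P gauss_borel \<and>
       finite_first_moment (rand_law P \<mu> \<sigma> \<kappa> S t x) \<and>
       (\<exists>!z. is_barycenter (rand_law P \<mu> \<sigma> \<kappa> S t x) z)) \<and>
    (\<forall>x\<in>K. \<forall>y\<in>K.
       gdist (rand_proj P \<mu> \<sigma> \<kappa> S t x) (rand_proj P \<mu> \<sigma> \<kappa> S t y) \<le> L * path_dist t x y) \<and>
    (\<forall>x\<in>K.
       (\<forall>u\<in>gauss_manifold. integrable (rand_law P \<mu> \<sigma> \<kappa> S t x) (\<lambda>v. (gdist u v)\<^sup>2)) \<and>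
       (\<forall>u. is_arg_min (\<lambda>u. \<integral>v. (gdist u v)\<^sup>2 \<partial>rand_law P \<mu> \<sigma> \<kappa> S t x)
              (\<lambda>u. u \<in> gauss_manifold) u \<longleftrightarrow> u = rand_proj P \<mu> \<sigma> \<kappa> S t x))"
proof -
  define C where "C = sqrt ((1 + L\<mu>)\<^sup>2 + (cosh (M + R))\<^sup>2 * L\<sigma>\<^sup>2 / 2)"
  have "0 \<le> 3 * C" by (simp add: C_def)
  show ?thesis
  proof (intro exI[of _ "3 * C"] conjI[OF \<open>0 \<le> 3 * C\<close>] allI impI)
    fix P :: "'w measure" and \<mu> :: "real \<times> (real^'d) \<Rightarrow> real^'d" and \<sigma> \<kappa> S W x0 X K
    assume V: "volterra_setting P L\<mu> L\<sigma> \<mu> \<sigma> \<kappa> S W x0 X"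
      and S_bound: "AE \<omega> in P. \<forall>s. norm (S s \<omega>) \<le> R"
      and \<sigma>_bound: "\<forall>(s::nat) x. norm (\<sigma> (real s, x)) \<le> M"
    interpret volterra_setting P L\<mu> L\<sigma> \<mu> \<sigma> \<kappa> S W x0 X by (rule V)
    interpret G: cn_space "gauss_manifold :: 'd gpoint set" gauss_dist by (rule cn_space_gauss_dist)
    define f where "f x \<omega> = Psi \<mu> \<sigma> \<kappa> t x (\<lambda>r. S r \<omega>)" for x \<omega>
    have law: "rand_law P \<mu> \<sigma> \<kappa> S t x = distr P gauss_borel (f x)" for x
      by (simp add: rand_law_def f_def[abs_def])
    have f: "f x \<in> measurable P gauss_borel" for x
      unfolding f_def by (rule Psi_measurable[OF \<sigma>_Sym S_Sym S_measurable])
    have sq: "G.square_integrable_map P (f x)" for x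
      unfolding f_def using \<sigma>_bound
      by (intro Psi_square_integrable[OF prob_space_axioms kernel \<sigma>_Sym S_Sym S_measurable S_bound]) auto
    note bary = is_barycenter_iff_minimizes_spread[OF f sq]
    have ex1: "\<exists>!z. is_barycenter (distr P gauss_borel (f x)) z" for x
      unfolding bary using G.ex_minimizes_spread[OF sq] G.minimizes_spread_unique[OF sq] by blast
    have proj: "G.minimizes_spread P (f x) (rand_proj P \<mu> \<sigma> \<kappa> S t x)" for x
      using theI'[OF ex1[of x]] unfolding rand_proj_def barycenter_def law bary .
    have lip: "gdist (rand_proj P \<mu> \<sigma> \<kappa> S t x) (rand_proj P \<mu> \<sigma> \<kappa> S t y) \<le> 3 * C * path_dist t x y" for x y
    proof -
      have "AE \<omega> in P. gauss_dist (f x \<omega>) (f y \<omega>) \<le> C * path_dist t x y"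
        using S_bound
      proof (rule AE_mp, intro AE_I2 impI)
        fix \<omega> assume "\<omega> \<in> space P" "\<forall>s. norm (S s \<omega>) \<le> R"
        then show "gauss_dist (f x \<omega>) (f y \<omega>) \<le> C * path_dist t x y"
          unfolding f_def C_def using \<sigma>_bound
          by (intro Psi_Lipschitz[OF kernel \<sigma>_Sym S_Sym _ _ lipschitz_\<mu> lipschitz_\<sigma>]) auto
      qed
      from G.minimizes_spread_Lipschitz[OF sq sq proj proj this]
      show ?thesis
        using proj[of x] proj[of y] by (simp add: G.minimizes_spread_def gauss_dist_def mult.assoc)
    qed
    have argmin: "is_arg_min (\<lambda>u. \<integral>v. (gdist u v)\<^sup>2 \<partial>rand_law P \<mu> \<sigma> \<kappa> S t x) (\<lambda>u. u \<in> gauss_manifold) u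
        \<longleftrightarrow> u = rand_proj P \<mu> \<sigma> \<kappa> S t x" for x u
      unfolding law is_arg_min_iff_minimizes_spread[OF f sq]
      using proj[of x] G.minimizes_spread_unique[OF sq] by blast
    show "(\<forall>x\<in>K.
       (\<lambda>\<omega>. Psi \<mu> \<sigma> \<kappa> t x (\<lambda>r. S r \<omega>)) \<in> measurable P gauss_borel \<and>
       finite_first_moment (rand_law P \<mu> \<sigma> \<kappa> S t x) \<and>
       (\<exists>!z. is_barycenter (rand_law P \<mu> \<sigma> \<kappa> S t x) z)) \<and>
    (\<forall>x\<in>K. \<forall>y\<in>K.
       gdist (rand_proj P \<mu> \<sigma> \<kappa> S t x) (rand_proj P \<mu> \<sigma> \<kappa> S t y) \<le> 3 * C * path_dist t x y) \<and>
    (\<forall>x\<in>K.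
       (\<forall>u\<in>gauss_manifold. integrable (rand_law P \<mu> \<sigma> \<kappa> S t x) (\<lambda>v. (gdist u v)\<^sup>2)) \<and>
       (\<forall>u. is_arg_min (\<lambda>u. \<integral>v. (gdist u v)\<^sup>2 \<partial>rand_law P \<mu> \<sigma> \<kappa> S t x)
              (\<lambda>u. u \<in> gauss_manifold) u \<longleftrightarrow> u = rand_proj P \<mu> \<sigma> \<kappa> S t x))"
      using f[unfolded f_def] ex1 finite_first_moment_distr[OF prob_space_axioms f sq]
        gdist_square_distr(1)[OF f sq] lip argmin
      unfolding law by blast
  qed
qed

end
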